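(* Let $K$ be a self-similar Cantor set with Hausdorff dimension greater than $1/2$. Then, for every $\epsilon > 0$ and $M > 0$, there exist a self-similar Cantor set $\widetilde{K}$ and a (Lebesgue measurable) set $E \subset (M^{-1}, M)$ such that (i) $\left| (M^{-1}, M) \setminus E \right| < \epsilon$; (ii) $\widetilde{K}$ is $\epsilon$-close to $K$; (iii) $\widetilde{K} + r \widetilde{K} = \{ x + r y : x, y \in \widetilde{K} \}$ contains an interval (of positive length) for all $r \in E$.
   Context: Write $I = [0,1]$. $|\cdot|$ denotes Lebesgue measure (length, for intervals); $\mathrm{conv}$ denotes convex hull. A (nonempty compact) set $K \subset \mathbb{R}$ is a self-similar Cantor set if there exist a finite alphabet $\mathcal{A}$ and a set of linear contractions $\mathcal{F} = \{ f_a \}_{a \in \mathcal{A}}$ on $\mathbb{R}$ (contracting similarities, $f_a(x) = \lambda_a x + b_a$ with $0 < |\lambda_a| < 1$) such that (i) $K = \bigcup_{a \in \mathcal{A}} f_a(K)$; (ii) the sets $f_a(\mathrm{conv}(K))$, $a \in \mathcal{A}$, are pairwise disjoint. In that case one says that $\mathcal{F}$ generates $K$. Without loss of generality it is always assumed that $K \subset I$. For $a \in \mathcal{A}$ write $I(a) = f_a(I)$. A given $K$ may be generated by several such families $\mathcal{F}$. Two closed intervals $I_1, I_2 \subset \mathbb{R}$ are $\epsilon$-close if (i) $1 - \epsilon < |I_1|/|I_2| < 1 + \epsilon$, and (ii) the distance between the centers of $I_1$ and $I_2$ is less than $\epsilon \min\{|I_1|, |I_2|\}$. Two self-similar Cantor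 sets $K, \widetilde{K}$ are $\epsilon$-close if there exist sets of contracting similarities $\mathcal{F} = \{f_a\}_{a \in \mathcal{A}}$ generating $K$ and $\widetilde{\mathcal{F}} = \{\tilde{f}_a\}_{a \in \mathcal{A}}$ generating $\widetilde{K}$, indexed by the same alphabet $\mathcal{A}$, such that $I(a) = f_a(I)$ and $\tilde{I}(a) = \tilde{f}_a(I)$ are $\epsilon$-close for all $a \in \mathcal{A}$. *)

theory Defs
  imports "HOL-Analysis.Analysis"
begin

(* The convention diameter(U)^0 = 1 for nonempty U (and 0 for empty U) makes the case s = 0 the counting
   measure. Boundedness is required because diameter is unspecified on unbounded sets. *)
definition hausdorff_gauge :: "real \<Rightarrow> 'a::metric_space set \<Rightarrow> ennreal" where
  "hausdorff_gauge s U =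
     (if U = {} then 0 else if s = 0 then 1 else ennreal (diameter U powr s))"

definition hausdorff_premeasure :: "real \<Rightarrow> real \<Rightarrow> 'a::metric_space set \<Rightarrow> ennreal" where
  "hausdorff_premeasure s \<delta> S =
     (INF U \<in> {U :: nat \<Rightarrow> 'a set. S \<subseteq> (\<Union>i. U i) \<and> (\<forall>i. bounded (U i) \<and> diameter (U i) \<le> \<delta>)}.
        (\<Sum>i. hausdorff_gauge s (U i)))"

definition hausdorff_measure :: "real \<Rightarrow> 'a::metric_space set \<Rightarrow> ennreal" where
  "hausdorff_measure s S = (SUP \<delta> \<in> {0<..}. hausdorff_premeasure s \<delta> S)"

definition hausdorff_dim :: "'a::metric_space set \<Rightarrow> ennreal" where
  "hausdorff_dim S = Inf {ennreal s | s. 0 \<le> s \<and> hausdorff_measure s S = 0}"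

definition contracting_similarity :: "(real \<Rightarrow> real) \<Rightarrow> bool" where
  "contracting_similarity f \<longleftrightarrow>
     (\<exists>c b. 0 < \<bar>c\<bar> \<and> \<bar>c\<bar> < 1 \<and> f = (\<lambda>x. c * x + b))"

definition generates :: "'i set \<Rightarrow> ('i \<Rightarrow> real \<Rightarrow> real) \<Rightarrow> real set \<Rightarrow> bool" where
  "generates A f K \<longleftrightarrow>
     finite A \<and> (\<forall>a\<in>A. contracting_similarity (f a)) \<and>
     K = (\<Union>a\<in>A. f a ` K) \<and>
     disjoint_family_on (\<lambda>a. f a ` (convex hull K)) A"

(* Alphabets are finite, so finite sets of naturals suffice. The standing normalisation that K
   lies in [0,1] is part of the definition. *)
definition self_similar_Cantor_set :: "real set \<Rightarrow> bool" where
  "self_similar_Cantor_set K \<longleftrightarrow>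
     K \<noteq> {} \<and> compact K \<and> K \<subseteq> {0..1} \<and>
     (\<exists>(A :: nat set) f. generates A f K)"

(* Only meant for compact intervals of positive length. *)
definition interval_center :: "real set \<Rightarrow> real" where
  "interval_center J = (Inf J + Sup J) / 2"

definition eps_close_intervals :: "real \<Rightarrow> real set \<Rightarrow> real set \<Rightarrow> bool" where
  "eps_close_intervals \<epsilon> J1 J2 \<longleftrightarrow>
     1 - \<epsilon> < measure lebesgue J1 / measure lebesgue J2 \<and>
     measure lebesgue J1 / measure lebesgue J2 < 1 + \<epsilon> \<and>
     \<bar>interval_center J1 - interval_center J2\<bar>
       < \<epsilon> * min (measure lebesgue J1) (measure lebesgue J2)"

(* The closeness condition concerns the images of the unit interval [0,1], whereas the
   disjointness condition in generates concerns the images of the convex hull. *)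
definition eps_close_Cantor_sets :: "real \<Rightarrow> real set \<Rightarrow> real set \<Rightarrow> bool" where
  "eps_close_Cantor_sets \<epsilon> K K' \<longleftrightarrow>
     (\<exists>(A :: nat set) f f'. generates A f K \<and> generates A f' K' \<and>
        (\<forall>a\<in>A. eps_close_intervals \<epsilon> (f a ` {0..1}) (f' a ` {0..1})))"

end

theory Submission
  imports Defs
begin

text \<open>If $K$ has dimension above $1/2$, then a random small perturbation $K'$ of $K$ has the property
that, for most $r$, the sum $K' + r K'$ contains an interval.

\<^bold>\<open>A homogeneous subsystem.\<close> If $c_a$ are the ratios of a system generating $K$, then covering $K$ by
the images of long words shows $\sum_a |c_a|^{1/2} > 1$ (\<open>sum_sqrt_ratio_gt_1\<close>). A word's ratio
depends only on its letter counts, so words of length $n$ have polynomially many ratios in $n$ and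
some ratio is shared by many words. This gives a finite set $B$ of words of one ratio $q > 0$ with
$\sigma = |B|^2 q > 1$ (\<open>exists_homogeneous_subsystem\<close>).

\<^bold>\<open>Renormalisation.\<close> Fix two distinct elements $\alpha, \omega$ of $B$ and set $\lambda = q^{k+1}$. For
$u, v \in B^k$ the maps of the words $\alpha u$ and $\omega v$ are $x \mapsto \lambda x + X_u$ and
$x \mapsto \lambda x + Y_v$. Only the former are perturbed, $X_u$ becoming $X_u + t_u$ with
$|t_u| \le \tau\lambda$, which is a small movement relative to the size of the pieces. Both maps
have ratio $\lambda$, so the renormalisation $x \mapsto (x - X_u - t_u - r Y_v)/\lambda$ keeps $r$.
A bounded set $\Omega$ each of whose points is sent into $\Omega$ by one of these maps
lies in $K' + r K'$ (\<open>invariant_set_subset_sum\<close>), so an $\Omega$ with interior is wanted.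

\<^bold>\<open>Energy.\<close> Let $z_{uv} = X_u + r Y_v$ and $h = \eta\lambda$. Distinct $Y_v$ are well separated, so a pair of pairs
satisfies $|z_{uv} - z_{u'v'}| < h$ for few values of $r$. Summing over all quadruples and over
a grid of values of $r$, the scales form a geometric series because $\sigma > 1$
(\<open>energy_sum_le\<close>). Hence for most $r$ the number of close pairs is at most a constant times
$|B|^{4k}\lambda$. For such $r$ the Cauchy--Schwarz inequality gives a window of length about
$\tau/4$ in which at least $\mathrm{const}/\lambda$ cells of length $h$ contain at least
$\mathrm{const}\cdot\sigma^k$ of the points $z_{uv}$ each (\<open>dense_window\<close>, \<open>good_ratio\<close>). In one cell
different points have different $u$.

\<^bold>\<open>Random translations.\<close> Let $a$ be the left end of the window. If $x - \lambda a$ lies in such a cell, every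
$(u, v)$ counted there renormalises $x$ to a point close to $a$, and a uniformly random $t_u$ moves that point
into one of the (shifted) cells with a probability bounded below independently of $k$. The $u$ are
independent, so all fail with probability at most $\exp(-\mathrm{const}\cdot\sigma^k)$. Only
polynomially many points $x$ and parameters $r$ in $1/\lambda$ need to be considered, so for large
$k$ one choice of $t$ works for all of them (\<open>exists_translations\<close>, \<open>exists_good_translations\<close>).
All randomness is a counting argument over a finite grid of translations.\<close>

section \<open>Counting lemmas\<close>

text \<open>The union bound for independent uniform choices $t_u \in D$: the event $i$ fails only if every
$u \in S_i$ misses its target $A_{i,u}$, which has density at least $p$ in $D$.
Probabilities are stated as proportions of the finite set of all choices.\<close>

lemma exists_choice_meeting_all:
  fixes A :: "'e \<Rightarrow> 'u \<Rightarrow> 'd set" and S :: "'e \<Rightarrow> 'u set" and p m :: real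
  assumes "finite U" "finite D" "D \<noteq> {}" "finite I"
    and S: "\<And>i. i \<in> I \<Longrightarrow> S i \<subseteq> U" "\<And>i. i \<in> I \<Longrightarrow> m \<le> card (S i)"
    and A: "\<And>i u. i \<in> I \<Longrightarrow> u \<in> S i \<Longrightarrow> A i u \<subseteq> D \<and> p * card D \<le> card (A i u)"
    and "0 \<le> p" and few: "card I * exp (- (p * m)) < 1"
  shows "\<exists>t \<in> U \<rightarrow> D. \<forall>i\<in>I. \<exists>u\<in>S i. t u \<in> A i u"
proof (rule ccontr)
  assume neg: "\<not> ?thesis"
  define bad where "bad i = Pi\<^sub>E U (\<lambda>u. if u \<in> S i then D - A i u else D)" for i
  have "t \<in> (\<Union>i\<in>I. bad i)" if t: "t \<in> Pi\<^sub>E U (\<lambda>_. D)" for t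
  proof -
    have "t \<in> U \<rightarrow> D" using t by auto
    then obtain i where i: "i \<in> I" "\<forall>u\<in>S i. t u \<notin> A i u" using neg by blast
    have "t \<in> bad i" using t i by (auto simp: bad_def PiE_iff)
    then show ?thesis using i by blast
  qed
  then have sub: "Pi\<^sub>E U (\<lambda>_. D) \<subseteq> (\<Union>i\<in>I. bad i)" by blast
  define d where "d = real (card D)"
  have d0: "d > 0" using assms(2,3) by (simp add: d_def card_gt_0_iff)
  have badle: "card (bad i) \<le> exp (- (p * m)) * d ^ card U" if i: "i \<in> I" for i
  proof -
    have dA: "card (D - A i u) \<le> exp (- p) * d" if u: "u \<in> S i" for u
    proof -
      have *: "A i u \<subseteq> D" "p * card D \<le> card (A i u)" using A[OF i u] by auto
      then have "real (card (D - A i u)) = d - card (A i u)"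
        using assms(2) by (simp add: card_Diff_subset finite_subset card_mono d_def of_nat_diff)
      also have "\<dots> \<le> (1 - p) * d" using * by (simp add: d_def algebra_simps)
      also have "\<dots> \<le> exp (- p) * d" using exp_ge_add_one_self[of "-p"] d0 by (intro mult_right_mono) auto
      finally show ?thesis .
    qed
    have "real (card (bad i)) = (\<Prod>u\<in>U. real (card (if u \<in> S i then D - A i u else D)))"
      using assms(1) by (simp add: bad_def card_PiE)
    also have "\<dots> \<le> (\<Prod>u\<in>U. (if u \<in> S i then exp (- p) else 1) * d)"
      using dA by (intro prod_mono) (auto simp: d_def)
    also have "\<dots> = (\<Prod>u\<in>U. if u \<in> S i then exp (- p) else 1) * d ^ card U"
      by (simp add: prod.distrib)
    also have "(\<Prod>u\<in>U. if u \<in> S i then exp (- p) else 1) = exp (- p) ^ card (S i)"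
      using assms(1) S(1)[OF i] by (simp add: prod.If_cases Int_absorb1)
    also have "\<dots> = exp (- (p * card (S i)))" by (simp add: exp_of_nat_mult[symmetric] mult.commute)
    also have "\<dots> \<le> exp (- (p * m))" using S(2)[OF i] \<open>0 \<le> p\<close> by (simp add: mult_left_mono)
    finally show ?thesis using d0 by (simp add: mult_right_mono)
  qed
  have fb: "finite (bad i)" for i unfolding bad_def using assms(1,2) by (intro finite_PiE) auto
  have "d ^ card U = real (card (Pi\<^sub>E U (\<lambda>_. D)))" using assms(1) by (simp add: card_PiE d_def)
  also have "\<dots> \<le> real (card (\<Union>i\<in>I. bad i))" using sub fb assms(4) by (simp add: card_mono)
  also have "\<dots> \<le> (\<Sum>i\<in>I. real (card (bad i)))"
    using card_UN_le[OF assms(4), of bad] unfolding of_nat_sum[symmetric] of_nat_le_iff .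
  also have "\<dots> \<le> (\<Sum>i\<in>I. exp (- (p * m)) * d ^ card U)" by (intro sum_mono badle)
  also have "\<dots> = (card I * exp (- (p * m))) * d ^ card U" by simp
  also have "\<dots> < 1 * d ^ card U" using few d0 by (intro mult_strict_right_mono) auto
  finally show False by simp
qed

text \<open>A finite family of points with few close pairs spreads over many cells of length $h$. Some window
of $H$ consecutive cells starting at $a$ carries at least a proportion $1/C_w$ of the points, at least half of which lie in
cells with at least half the average number of points. The Cauchy--Schwarz inequality bounds the
number of these cells from below.\<close>

lemma dense_window:
  fixes z :: "'p \<Rightarrow> real" and R h En Cw :: real and H :: nat
  assumes "finite P" and z: "\<And>p. p \<in> P \<Longrightarrow> \<bar>z p\<bar> \<le> R" and "0 \<le> R" "0 < h" "0 < H"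
    and En: "card {(p, p'). p \<in> P \<and> p' \<in> P \<and> \<bar>z p - z p'\<bar> < h} \<le> En"
    and Cw: "2 * R / (H * h) + 2 \<le> Cw"
  shows "\<exists>a Q. \<bar>a\<bar> \<le> R + H * h \<and> Q \<subseteq> {0..<int H} \<and>
           (card P / (2 * Cw))\<^sup>2 \<le> card Q * En \<and>
           (\<forall>q\<in>Q. card P / (2 * Cw * H) \<le> card {p\<in>P. \<lfloor>(z p - a) / h\<rfloor> = q})"
proof -
  define l where "l = H * h"
  have l0: "l > 0" using assms by (simp add: l_def)
  have Cw0: "Cw > 0" using Cw assms l0 by (smt (verit) divide_nonneg_pos l_def)
  define G where "G = {\<lfloor>-R/l\<rfloor>..\<lfloor>R/l\<rfloor>}"
  have "\<lfloor>-R/l\<rfloor> \<le> \<lfloor>R/l\<rfloor>" using assms l0 by (intro floor_mono divide_right_mono) auto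
  then have Gne: "G \<noteq> {}" by (simp add: G_def)
  have "real (card G) = real_of_int (\<lfloor>R/l\<rfloor> + 1 - \<lfloor>-R/l\<rfloor>)"
    using \<open>\<lfloor>-R/l\<rfloor> \<le> \<lfloor>R/l\<rfloor>\<close> by (simp add: G_def)
  also have "\<dots> \<le> R/l + 1 - (-R/l - 1)" by linarith
  also have "\<dots> = 2 * R / l + 2" by simp
  also have "\<dots> \<le> Cw" using Cw by (simp only: l_def)
  finally have Gc: "card G \<le> Cw" .
  have inG: "\<lfloor>z p / l\<rfloor> \<in> G" if "p \<in> P" for p
    using z[OF that] l0 unfolding G_def atLeastAtMost_iff
    by (intro conjI floor_mono divide_right_mono) auto
  have "\<exists>j\<in>G. card P / Cw \<le> card {p\<in>P. \<lfloor>z p / l\<rfloor> = j}"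
  proof (rule ccontr)
    assume "\<not> ?thesis"
    then have lt: "\<And>j. j \<in> G \<Longrightarrow> card {p\<in>P. \<lfloor>z p / l\<rfloor> = j} < card P / Cw" by force
    have "P = (\<Union>j\<in>G. {p\<in>P. \<lfloor>z p / l\<rfloor> = j})" using inG by auto
    then have "card P \<le> (\<Sum>j\<in>G. card {p\<in>P. \<lfloor>z p / l\<rfloor> = j})"
      using card_UN_le[of G "\<lambda>j. {p\<in>P. \<lfloor>z p / l\<rfloor> = j}"] by (simp add: G_def)
    then have "real (card P) \<le> (\<Sum>j\<in>G. real (card {p\<in>P. \<lfloor>z p / l\<rfloor> = j}))"
      unfolding of_nat_sum[symmetric] of_nat_le_iff .
    also have "\<dots> < (\<Sum>j\<in>G. card P / Cw)" using Gne lt by (intro sum_strict_mono) (auto simp: G_def)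
    also have "\<dots> = card G * (card P / Cw)" by simp
    also have "\<dots> \<le> Cw * (card P / Cw)" using Gc Cw0 by (intro mult_right_mono) auto
    also have "\<dots> = card P" using Cw0 by simp
    finally show False by simp
  qed
  then obtain j where j: "j \<in> G" "card P / Cw \<le> card {p\<in>P. \<lfloor>z p / l\<rfloor> = j}" by blast
  define a where "a = j * l"
  define n where "n q = real (card {p\<in>P. \<lfloor>(z p - a) / h\<rfloor> = q})" for q
  define th where "th = card P / (2 * Cw * H)"
  \<comment> \<open>cells holding fewer than this threshold contain at most half of the points of the window\<close>
  define Q where "Q = {q\<in>{0..<int H}. th \<le> n q}"
  have "real_of_int j \<le> R / l" "-R/l - 1 \<le> real_of_int j" using j(1) by (auto simp: G_def) linarith+
  then have "real_of_int j * l \<le> R" "-R - l \<le> real_of_int j * l" using l0 by (auto simp: field_simps)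
  then have abnd: "\<bar>a\<bar> \<le> R + H * h" unfolding a_def abs_le_iff using l0 by (auto simp: l_def)
  have fib: "{p\<in>P. \<lfloor>z p / l\<rfloor> = j} \<subseteq> (\<Union>q\<in>{0..<int H}. {p\<in>P. \<lfloor>(z p - a) / h\<rfloor> = q})"
  proof
    fix p assume "p \<in> {p\<in>P. \<lfloor>z p / l\<rfloor> = j}"
    then have p: "p \<in> P" "\<lfloor>z p / l\<rfloor> = j" by auto
    then have "j \<le> z p / l" "z p / l < j + 1" by linarith+
    then have "a \<le> z p" "z p < a + l" using l0 by (auto simp: a_def field_simps)
    then have "0 \<le> (z p - a)/h" "(z p - a)/h < H" using assms by (auto simp: l_def field_simps)
    then have "0 \<le> \<lfloor>(z p - a)/h\<rfloor>" "\<lfloor>(z p - a)/h\<rfloor> < int H" by (auto simp: floor_less_iff)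
    then show "p \<in> (\<Union>q\<in>{0..<int H}. {p\<in>P. \<lfloor>(z p - a) / h\<rfloor> = q})" using p by auto
  qed
  have "card {p\<in>P. \<lfloor>z p / l\<rfloor> = j} \<le> card (\<Union>q\<in>{0..<int H}. {p\<in>P. \<lfloor>(z p - a) / h\<rfloor> = q})"
    using fib assms(1) by (intro card_mono) auto
  also have "\<dots> \<le> (\<Sum>q\<in>{0..<int H}. card {p\<in>P. \<lfloor>(z p - a) / h\<rfloor> = q})" by (intro card_UN_le) auto
  finally have "real (card {p\<in>P. \<lfloor>z p / l\<rfloor> = j}) \<le> (\<Sum>q\<in>{0..<int H}. n q)"
    unfolding n_def of_nat_sum[symmetric] of_nat_le_iff .
  with j have tot: "card P / Cw \<le> (\<Sum>q\<in>{0..<int H}. n q)" by linarith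
  have "(\<Sum>q\<in>{0..<int H}. n q) = (\<Sum>q\<in>Q. n q) + (\<Sum>q\<in>{0..<int H}-Q. n q)"
    by (subst add.commute, rule sum.subset_diff) (auto simp: Q_def)
  also have "(\<Sum>q\<in>{0..<int H}-Q. n q) \<le> (\<Sum>q\<in>{0..<int H}-Q. th)"
    by (intro sum_mono) (auto simp: Q_def)
  also have "\<dots> \<le> (\<Sum>q\<in>{0..<int H}. th)"
    using Cw0 by (intro sum_mono2) (auto simp: th_def)
  also have "\<dots> = card P / (2 * Cw)" using assms(5) by (simp add: th_def)
  finally have "card P / Cw \<le> sum n Q + card P / (2 * Cw)" using tot by linarith
  then have sQ: "card P / (2 * Cw) \<le> sum n Q" by (simp add: field_simps)
  have fQ: "finite Q" unfolding Q_def by (rule finite_subset[of _ "{0..<int H}"]) auto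
  have "(\<Sum>q\<in>Q. (n q)\<^sup>2) \<le> En"
  proof -
    let ?F = "\<lambda>q. {p\<in>P. \<lfloor>(z p - a) / h\<rfloor> = q}"
    have "(\<Sum>q\<in>Q. (n q)\<^sup>2) = real (\<Sum>q\<in>Q. card (?F q \<times> ?F q))"
      by (simp add: n_def power2_eq_square card_cartesian_product)
    also have "(\<Sum>q\<in>Q. card (?F q \<times> ?F q)) = card (\<Union>q\<in>Q. ?F q \<times> ?F q)"
      using fQ assms(1) by (intro card_UN_disjoint[symmetric]) auto
    also have "\<dots> \<le> card {(p, p'). p \<in> P \<and> p' \<in> P \<and> \<bar>z p - z p'\<bar> < h}"
    proof (rule card_mono)
      show "finite {(p, p'). p \<in> P \<and> p' \<in> P \<and> \<bar>z p - z p'\<bar> < h}"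
        by (rule finite_subset[of _ "P \<times> P"]) (use assms(1) in auto)
      have "\<bar>z p - z p'\<bar> < h" if "\<lfloor>(z p - a) / h\<rfloor> = \<lfloor>(z p' - a) / h\<rfloor>" for p p'
      proof -
        have "\<bar>(z p - a) / h - (z p' - a) / h\<bar> < 1" using that by linarith
        also have "(z p - a) / h - (z p' - a) / h = (z p - z p') / h" by (simp add: diff_divide_distrib)
        finally show ?thesis using assms(4) by (simp add: field_simps)
      qed
      then show "(\<Union>q\<in>Q. ?F q \<times> ?F q) \<subseteq> {(p, p'). p \<in> P \<and> p' \<in> P \<and> \<bar>z p - z p'\<bar> < h}"
        by auto
    qed
    finally show ?thesis using En by linarith
  qed
  moreover have "(sum n Q)\<^sup>2 \<le> (\<Sum>q\<in>Q. (n q)\<^sup>2) * card Q" by (rule sum_squared_le_sum_of_squares)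
  ultimately have "(sum n Q)\<^sup>2 \<le> En * card Q" by (meson mult_right_mono of_nat_0_le_iff order_trans)
  moreover have "(card P / (2 * Cw))\<^sup>2 \<le> (sum n Q)\<^sup>2" using sQ Cw0 by (intro power_mono) auto
  ultimately have "(card P / (2 * Cw))\<^sup>2 \<le> card Q * En" by (simp add: mult.commute)
  moreover have "\<forall>q\<in>Q. card P / (2 * Cw * H) \<le> card {p\<in>P. \<lfloor>(z p - a) / h\<rfloor> = q}"
    by (auto simp: Q_def n_def th_def)
  moreover have "Q \<subseteq> {0..<int H}" by (auto simp: Q_def)
  ultimately show ?thesis using abnd by blast
qed

lemma card_separated_le:
  fixes S :: "real set"
  assumes "finite S" "S \<subseteq> {z..z + R}" "0 < \<delta>" "0 \<le> R"
    and sep: "\<And>x y. x \<in> S \<Longrightarrow> y \<in> S \<Longrightarrow> x \<noteq> y \<Longrightarrow> \<delta> \<le> \<bar>x - y\<bar>"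
  shows "card S \<le> R / \<delta> + 1"
proof -
  let ?f = "\<lambda>x. \<lfloor>(x - z) / \<delta>\<rfloor>"
  have "inj_on ?f S"
  proof (rule inj_onI, rule ccontr)
    fix x y assume xy: "x \<in> S" "y \<in> S" "?f x = ?f y" "x \<noteq> y"
    then have "\<bar>(x - z) / \<delta> - (y - z) / \<delta>\<bar> < 1" by linarith
    also have "(x - z) / \<delta> - (y - z) / \<delta> = (x - y) / \<delta>" by (simp add: diff_divide_distrib)
    finally have "\<bar>x - y\<bar> < \<delta>" using assms(3) by (simp add: field_simps)
    then show False using sep[OF xy(1,2,4)] by simp
  qed
  moreover have "?f ` S \<subseteq> {0..\<lfloor>R / \<delta>\<rfloor>}"
    using assms(2,3) by (fastforce intro!: floor_mono divide_right_mono divide_nonneg_pos)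
  ultimately have "card S \<le> card {0..\<lfloor>R / \<delta>\<rfloor>}"
    by (metis card_image card_mono finite_atLeastAtMost_int)
  also have "real (card {0..\<lfloor>R / \<delta>\<rfloor>}) \<le> R / \<delta> + 1"
  proof -
    have "0 \<le> \<lfloor>R / \<delta>\<rfloor>" using assms by simp
    then show ?thesis by simp
  qed
  finally show ?thesis by simp
qed

section \<open>Words of affine maps, gaps and attractors\<close>

text \<open>The words of length $n$ over the alphabet $A$.\<close>

definition words :: "'i set \<Rightarrow> nat \<Rightarrow> 'i list set" where
  "words A n = {w. set w \<subseteq> A \<and> length w = n}"

text \<open>The map attached to a word is the composition of the maps $x \mapsto c_a x + d_a$ of its letters,
the first letter being applied last. It is $x \mapsto \kappa x + b$ with $\kappa = $ \<open>word_ratio c w\<close> and $b = $ \<open>word_offset c d w\<close>.\<close>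

definition word_ratio :: "('i \<Rightarrow> real) \<Rightarrow> 'i list \<Rightarrow> real" where
  "word_ratio c w = prod_list (map c w)"

primrec word_offset :: "('i \<Rightarrow> real) \<Rightarrow> ('i \<Rightarrow> real) \<Rightarrow> 'i list \<Rightarrow> real" where
  "word_offset c d [] = 0"
| "word_offset c d (a # w) = c a * word_offset c d w + d a"

lemma word_ratio_simps [simp]:
  "word_ratio c [] = 1" "word_ratio c (a # w) = c a * word_ratio c w"
  by (simp_all add: word_ratio_def)

lemma word_ratio_append: "word_ratio c (u @ w) = word_ratio c u * word_ratio c w"
  by (simp add: word_ratio_def)

lemma word_offset_append:
  "word_offset c d (u @ w) = word_ratio c u * word_offset c d w + word_offset c d u"
  by (induction u) (auto simp: algebra_simps)

lemma word_ratio_const: "word_ratio (\<lambda>_. q) w = q ^ length w"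
  by (induction w) auto

lemma finite_words [intro, simp]: "finite A \<Longrightarrow> finite (words A n)"
  unfolding words_def by (rule finite_lists_length_eq)

lemma card_words: "finite A \<Longrightarrow> card (words A n) = card A ^ n"
  unfolding words_def by (rule card_lists_length_eq)

lemma words_0 [simp]: "words A 0 = {[]}"
  by (auto simp: words_def)

lemma words_Suc: "words A (Suc n) = (\<lambda>(a, w). a # w) ` (A \<times> words A n)"
  by (auto simp: words_def length_Suc_conv image_iff)

lemma words_Cons_iff: "a # w \<in> words A (Suc n) \<longleftrightarrow> a \<in> A \<and> w \<in> words A n"
  by (auto simp: words_def)

lemma sum_words_Suc:
  assumes "finite A"
  shows "(\<Sum>w\<in>words A (Suc n). g w) = (\<Sum>a\<in>A. \<Sum>w\<in>words A n. g (a # w))"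
  unfolding words_Suc
  by (subst sum.reindex) (auto simp: inj_on_def sum.cartesian_product assms intro!: sum.cong)

text \<open>A generating family of a self-similar Cantor set, with the affine maps given by their coefficients
and $[lo, hi]$ standing for the convex hull of $K$.\<close>

locale affine_ifs =
  fixes A :: "'i set" and c d :: "'i \<Rightarrow> real" and K :: "real set" and lo hi :: real
  assumes finite_A: "finite A"
    and ratio: "\<And>a. a \<in> A \<Longrightarrow> 0 < \<bar>c a\<bar> \<and> \<bar>c a\<bar> < 1"
    and K_ne: "K \<noteq> {}"
    and K_eq: "K = (\<Union>a\<in>A. (\<lambda>x. c a * x + d a) ` K)"
    and hull: "convex hull K = {lo..hi}"
    and unit: "0 \<le> lo" "hi \<le> 1"
    and disj: "disjoint_family_on (\<lambda>a. (\<lambda>x. c a * x + d a) ` {lo..hi}) A"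
begin

lemma lo_le_hi: "lo \<le> hi"
  using K_ne hull by (metis atLeastatMost_empty_iff convex_hull_eq_empty)

lemma K_sub: "K \<subseteq> {lo..hi}"
  using hull hull_subset by metis

lemma A_ne: "A \<noteq> {}"
  using K_ne K_eq by auto

lemma map_hull:
  assumes "a \<in> A" "x \<in> {lo..hi}"
  shows "c a * x + d a \<in> {lo..hi}"
proof -
  have "(\<lambda>x. d a + c a *\<^sub>R x) ` (convex hull K) = convex hull ((\<lambda>x. d a + c a *\<^sub>R x) ` K)"
    by (rule convex_hull_affinity[symmetric])
  also have "\<dots> \<subseteq> convex hull K"
    using K_eq assms(1) by (intro hull_mono) (auto simp: add.commute)
  finally show ?thesis using assms hull by (auto simp: add.commute image_subset_iff)
qed

abbreviation "wr \<equiv> word_ratio c"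
abbreviation "wo \<equiv> word_offset c d"

lemma wr_ne0: "w \<in> words A n \<Longrightarrow> wr w \<noteq> 0"
proof (induction w arbitrary: n)
  case (Cons a w)
  then obtain m where "n = Suc m" "a \<in> A" "w \<in> words A m" by (auto simp: words_def)
  then show ?case using Cons.IH[of m] ratio[of a] by auto
qed simp

lemma wr_le1: "w \<in> words A n \<Longrightarrow> \<bar>wr w\<bar> \<le> 1"
proof (induction w arbitrary: n)
  case (Cons a w)
  then obtain m where "n = Suc m" "a \<in> A" "w \<in> words A m" by (auto simp: words_def)
  then show ?case using Cons.IH[of m] ratio[of a] by (auto simp: abs_mult intro!: mult_le_one)
qed simp

lemma wr_lt1: "w \<in> words A (Suc n) \<Longrightarrow> \<bar>wr w\<bar> < 1"
proof -
  assume "w \<in> words A (Suc n)"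
  then obtain a u where w: "w = a # u" "a \<in> A" "u \<in> words A n" by (auto simp: words_Suc)
  have "\<bar>c a\<bar> * \<bar>wr u\<bar> \<le> \<bar>c a\<bar> * 1" using wr_le1[OF w(3)] by (intro mult_left_mono) auto
  also have "\<dots> < 1" using ratio[OF w(2)] by simp
  finally show "\<bar>wr w\<bar> < 1" using w by (simp add: abs_mult)
qed

lemma word_map_hull:
  "w \<in> words A n \<Longrightarrow> x \<in> {lo..hi} \<Longrightarrow> wr w * x + wo w \<in> {lo..hi}"
proof (induction w arbitrary: n)
  case (Cons a w)
  then obtain m where m: "n = Suc m" "a \<in> A" "w \<in> words A m" by (auto simp: words_def)
  have "c a * (wr w * x + wo w) + d a \<in> {lo..hi}"
    using Cons.IH[OF m(3) Cons.prems(2)] m(2) map_hull by blast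
  then show ?case by (simp add: algebra_simps)
qed simp

lemma K_words: "K = (\<Union>w\<in>words A n. (\<lambda>x. wr w * x + wo w) ` K)"
proof (induction n)
  case (Suc n)
  have "(\<Union>w\<in>words A (Suc n). (\<lambda>x. wr w * x + wo w) ` K)
      = (\<Union>a\<in>A. (\<lambda>x. c a * x + d a) ` (\<Union>w\<in>words A n. (\<lambda>x. wr w * x + wo w) ` K))"
    unfolding words_Suc by (auto simp: image_iff algebra_simps; blast)
  also have "\<dots> = K" using Suc K_eq by simp
  finally show ?case by simp
qed simp

lemma letter_gap:
  "\<exists>g>0. \<forall>a\<in>A. \<forall>b\<in>A. \<forall>x\<in>{lo..hi}. \<forall>y\<in>{lo..hi}.
     a \<noteq> b \<longrightarrow> g \<le> \<bar>(c a * x + d a) - (c b * y + d b)\<bar>"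
proof -
  let ?P = "{(a, b). a \<in> A \<and> b \<in> A \<and> a \<noteq> b}"
  have "finite ?P" by (rule finite_subset[of _ "A \<times> A"]) (use finite_A in auto)
  let ?Q = "\<lambda>p g. 0 < g \<and> (\<forall>x\<in>{lo..hi}. \<forall>y\<in>{lo..hi}.
      g \<le> \<bar>(c (fst p) * x + d (fst p)) - (c (snd p) * y + d (snd p))\<bar>)"
  have ex: "\<exists>g. ?Q p g" if "p \<in> ?P" for p
  proof -
    let ?S = "(\<lambda>x. c (fst p) * x + d (fst p)) ` {lo..hi}"
    let ?T = "(\<lambda>x. c (snd p) * x + d (snd p)) ` {lo..hi}"
    have "compact ?S" "compact ?T" by (intro compact_continuous_image continuous_intros compact_Icc)+
    moreover have "?S \<inter> ?T = {}"
      using that by (intro disjoint_family_onD[OF disj]) auto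
    ultimately obtain g where "g > 0" "\<forall>x\<in>?S. \<forall>y\<in>?T. g \<le> dist x y"
      using separate_compact_closed[of ?S ?T] compact_imp_closed by blast
    then show ?thesis by (auto simp: dist_real_def)
  qed
  define G where "G p = (SOME g. ?Q p g)" for p
  have G: "?Q p (G p)" if "p \<in> ?P" for p
    using someI_ex[OF ex[OF that]] unfolding G_def .
  define g where "g = Min (insert 1 (G ` ?P))"
  have fin: "finite (insert 1 (G ` ?P))" using \<open>finite ?P\<close> by simp
  show ?thesis
  proof (intro exI[of _ g] conjI ballI impI)
    show "0 < g" unfolding g_def using fin G by (subst Min_gr_iff) auto
    fix a b x y assume *: "a \<in> A" "b \<in> A" "x \<in> {lo..hi}" "y \<in> {lo..hi}" "a \<noteq> b"
    have "g \<le> G (a, b)" unfolding g_def using fin * by (intro Min_le) auto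
    also have "\<dots> \<le> \<bar>(c a * x + d a) - (c b * y + d b)\<bar>" using G[of "(a, b)"] * by auto
    finally show "g \<le> \<bar>(c a * x + d a) - (c b * y + d b)\<bar>" .
  qed
qed

text \<open>Images of the hull under distinct words of equal length are separated proportionally to their
own size. Only the size of the first word occurs, but the roles of the two words can be exchanged.\<close>

lemma word_gap:
  "\<exists>g>0. \<forall>n. \<forall>w\<in>words A n. \<forall>w'\<in>words A n. \<forall>x\<in>{lo..hi}. \<forall>y\<in>{lo..hi}. w \<noteq> w' \<longrightarrow>
     g * \<bar>wr w\<bar> \<le> \<bar>(wr w * x + wo w) - (wr w' * y + wo w')\<bar>"
proof -
  obtain g where g: "0 < g" "\<forall>a\<in>A. \<forall>b\<in>A. \<forall>x\<in>{lo..hi}. \<forall>y\<in>{lo..hi}.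
      a \<noteq> b \<longrightarrow> g \<le> \<bar>(c a * x + d a) - (c b * y + d b)\<bar>"
    using letter_gap by blast
  have "g * \<bar>wr w\<bar> \<le> \<bar>(wr w * x + wo w) - (wr w' * y + wo w')\<bar>"
    if "w \<in> words A n" "w' \<in> words A n" "w \<noteq> w'" "x \<in> {lo..hi}" "y \<in> {lo..hi}" for n w w' x y
    using that
  proof (induction n arbitrary: w w')
    case (Suc n)
    then obtain a u b v where w: "w = a # u" "a \<in> A" "u \<in> words A n"
      and w': "w' = b # v" "b \<in> A" "v \<in> words A n" by (auto simp: words_Suc)
    let ?x = "wr u * x + wo u" and ?y = "wr v * y + wo v"
    have xy: "?x \<in> {lo..hi}" "?y \<in> {lo..hi}" using word_map_hull w w' Suc.prems by blast+
    have eq: "(wr w * x + wo w) - (wr w' * y + wo w') = (c a * ?x + d a) - (c b * ?y + d b)"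
      by (simp add: w w' algebra_simps)
    show ?case
    proof (cases "a = b")
      case True
      have "g * \<bar>wr w\<bar> = \<bar>c a\<bar> * (g * \<bar>wr u\<bar>)" by (simp add: w abs_mult)
      also have "\<dots> \<le> \<bar>c a\<bar> * \<bar>?x - ?y\<bar>"
        using Suc.IH[OF w(3) w'(3) _ Suc.prems(4,5)] Suc.prems(3) w w' True
        by (intro mult_left_mono) auto
      also have "\<dots> = \<bar>(c a * ?x + d a) - (c b * ?y + d b)\<bar>"
        by (simp add: True abs_mult[symmetric] algebra_simps)
      finally show ?thesis using eq by simp
    next
      case False
      have "g * \<bar>wr w\<bar> \<le> g * 1" using wr_le1[OF Suc.prems(1)] g(1) by (intro mult_left_mono) auto
      also have "\<dots> \<le> \<bar>(c a * ?x + d a) - (c b * ?y + d b)\<bar>" using g(2) w(2) w'(2) False xy by simp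
      finally show ?thesis using eq by simp
    qed
  qed simp
  then show ?thesis using g(1) by blast
qed

end

text \<open>The attractor is the intersection of the iterated images of $[lo, hi]$. Disjointness of the first
images makes the letter in $x = c_a y_n + d_a$ independent of $n$, so that no
compactness argument is needed to see that the intersection is contained in its image.\<close>

lemma attractor_exists:
  fixes c d :: "'i \<Rightarrow> real"
  assumes "finite A" "A \<noteq> {}" "lo \<le> hi"
    and ratio: "\<And>a. a \<in> A \<Longrightarrow> c a \<noteq> 0"
    and into: "\<And>a x. a \<in> A \<Longrightarrow> x \<in> {lo..hi} \<Longrightarrow> c a * x + d a \<in> {lo..hi}"
    and disj: "disjoint_family_on (\<lambda>a. (\<lambda>x. c a * x + d a) ` {lo..hi}) A"
  shows "\<exists>K. compact K \<and> K \<noteq> {} \<and> K \<subseteq> {lo..hi} \<and> K = (\<Union>a\<in>A. (\<lambda>x. c a * x + d a) ` K)"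
proof -
  define F where "F S = (\<Union>a\<in>A. (\<lambda>x. c a * x + d a) ` S)" for S
  define S where "S n = (F ^^ n) {lo..hi}" for n
  have S0: "S 0 = {lo..hi}" and SS: "\<And>n. S (Suc n) = F (S n)" by (simp_all add: S_def)
  have mono: "F X \<subseteq> F Y" if "X \<subseteq> Y" for X Y using that by (auto simp: F_def)
  have dec: "S (Suc n) \<subseteq> S n" for n
  proof (induction n)
    case 0 then show ?case using into by (auto simp: SS S0 F_def)
  next
    case (Suc n) then show ?case using mono SS by metis
  qed
  have dec': "S n \<subseteq> S m" if "m \<le> n" for m n using lift_Suc_antimono_le[of S, OF dec that] .
  have cmp: "compact (S n)" for n
    by (induction n) (auto simp: S0 SS F_def assms(1) intro!: compact_UN compact_continuous_image continuous_intros)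
  have ne: "S n \<noteq> {}" for n
    by (induction n) (use assms in \<open>auto simp: S0 SS F_def\<close>)
  define K where "K = (\<Inter>n. S n)"
  have "K \<noteq> {}" unfolding K_def using compact_nest[of S] cmp ne dec' by blast
  moreover have "compact K" 
  proof -
    have "closed K" unfolding K_def using cmp compact_imp_closed by blast
    moreover have "bounded K" by (rule bounded_subset[of "S 0"]) (use S0 in \<open>auto simp: K_def\<close>)
    ultimately show ?thesis by (simp add: compact_eq_bounded_closed)
  qed
  moreover have "K \<subseteq> {lo..hi}" unfolding K_def S0[symmetric] by blast
  moreover have "K = F K"
  proof
    show "F K \<subseteq> K"
    proof -
      have "F K \<subseteq> S n" for n
      proof -
        have "F K \<subseteq> S (Suc n)" unfolding SS by (rule mono) (auto simp: K_def)
        then show ?thesis using dec by blast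
      qed
      then show ?thesis unfolding K_def by blast
    qed
    show "K \<subseteq> F K"
    proof
      fix x assume x: "x \<in> K"
      have "\<exists>a\<in>A. \<exists>y\<in>S n. x = c a * y + d a" for n
      proof -
        have "x \<in> S (Suc n)" using x unfolding K_def by blast
        then show ?thesis unfolding SS F_def by blast
      qed
      then obtain a y where ay: "\<And>n. a n \<in> A" "\<And>n. y n \<in> S n" "\<And>n. x = c (a n) * y n + d (a n)"
        by metis
      have yJ: "y n \<in> {lo..hi}" for n using ay(2)[of n] dec'[of 0 n] S0 by auto
      have aeq: "a n = a 0" for n
      proof (rule ccontr)
        assume "a n \<noteq> a 0"
        then have "(\<lambda>x. c (a n) * x + d (a n)) ` {lo..hi} \<inter> (\<lambda>x. c (a 0) * x + d (a 0)) ` {lo..hi} = {}"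
          using ay(1) by (intro disjoint_family_onD[OF disj]) auto
        then show False using ay(3) yJ by (metis (no_types, lifting) disjoint_iff imageI)
      qed
      have "y n = y 0" for n
        using ay(3)[of n] ay(3)[of 0] aeq[of n] ratio[OF ay(1)[of 0]] by simp
      then have "y 0 \<in> K" unfolding K_def using ay(2) by (metis INT_I)
      then show "x \<in> F K" using ay(1,3) by (auto simp: F_def)
    qed
  qed
  ultimately show ?thesis unfolding F_def by (intro exI[of _ K] conjI)
qed

section \<open>Homogeneous systems and transversality\<close>

text \<open>For words of equal length, the length of what remains after their longest common prefix, which is
$0$ exactly when the words are equal. On words of different length the value is irrelevant.\<close>

fun branch_height :: "'i list \<Rightarrow> 'i list \<Rightarrow> nat" where
  "branch_height (i # u) (j # v) = (if i = j then branch_height u v else Suc (length u))"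
| "branch_height _ _ = 0"

lemma branch_height_le: "branch_height u v \<le> length u"
  by (induction u v rule: branch_height.induct) auto

lemma branch_height_pos: "length u = length v \<Longrightarrow> u \<noteq> v \<Longrightarrow> 0 < branch_height u v"
  by (induction u v rule: branch_height.induct) auto

lemma sum_branch_height:
  fixes \<theta> :: real
  assumes "finite B" "0 \<le> \<theta>"
  shows "u \<in> words B k \<Longrightarrow>
    (\<Sum>v\<in>words B k. \<theta> ^ branch_height u v) \<le> (\<Sum>j\<le>k. (card B * \<theta>) ^ j)"
proof (induction k arbitrary: u)
  case (Suc k)
  then obtain i u' where u: "u = i # u'" "i \<in> B" "u' \<in> words B k" by (auto simp: words_Suc)
  have len: "length u' = k" using u(3) by (simp add: words_def)
  have "(\<Sum>v\<in>words B (Suc k). \<theta> ^ branch_height u v)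
      = (\<Sum>a\<in>B. \<Sum>v\<in>words B k. \<theta> ^ branch_height u (a # v))"
    by (rule sum_words_Suc[OF assms(1)])
  also have "\<dots> = (\<Sum>v\<in>words B k. \<theta> ^ branch_height u (i # v))
      + (\<Sum>a\<in>B-{i}. \<Sum>v\<in>words B k. \<theta> ^ branch_height u (a # v))"
    using u(2) assms(1) by (simp add: sum.remove)
  also have "(\<Sum>v\<in>words B k. \<theta> ^ branch_height u (i # v)) \<le> (\<Sum>j\<le>k. (card B * \<theta>) ^ j)"
    using Suc.IH[OF u(3)] by (simp add: u(1))
  also have "(\<Sum>a\<in>B-{i}. \<Sum>v\<in>words B k. \<theta> ^ branch_height u (a # v))
      = (\<Sum>a\<in>B-{i}. card (words B k) * \<theta> ^ Suc k)"
    by (intro sum.cong refl) (auto simp: u(1) len)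
  also have "\<dots> \<le> (\<Sum>a\<in>B. card (words B k) * \<theta> ^ Suc k)"
    using assms by (intro sum_mono2) auto
  also have "\<dots> = (card B * \<theta>) ^ Suc k"
    using assms(1) by (simp add: card_words power_mult_distrib)
  finally show ?case by simp
qed simp

lemma card_times_near_le:
  fixes x \<delta> h :: real
  assumes "finite S" "\<delta> \<noteq> 0" "0 < h"
  shows "card {s::nat \<in> S. \<bar>x + s * \<delta>\<bar> < h} \<le> 2 * h / \<bar>\<delta>\<bar> + 1"
proof -
  let ?S = "{s::nat \<in> S. \<bar>x + s * \<delta>\<bar> < h}"
  have inj: "inj_on (\<lambda>s. s * \<delta>) (UNIV :: nat set)" using assms(2) by (auto simp: inj_on_def)
  have "card ?S = card ((\<lambda>s. s * \<delta>) ` ?S)"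
    by (rule card_image[symmetric]) (rule inj_on_subset[OF inj], simp)
  also have "real \<dots> \<le> 2 * h / \<bar>\<delta>\<bar> + 1"
  proof (rule card_separated_le[where z = "- x - h"])
    show "\<bar>\<delta>\<bar> \<le> \<bar>a - b\<bar>" if "a \<in> (\<lambda>s. s * \<delta>) ` ?S" "b \<in> (\<lambda>s. s * \<delta>) ` ?S" "a \<noteq> b" for a b
    proof -
      from that obtain s t :: nat where st: "a = s * \<delta>" "b = t * \<delta>" "s \<noteq> t" by auto
      then have "1 \<le> \<bar>real s - real t\<bar>" by linarith
      then have "1 * \<bar>\<delta>\<bar> \<le> \<bar>real s - real t\<bar> * \<bar>\<delta>\<bar>" by (intro mult_right_mono) auto
      then show ?thesis by (simp add: st abs_mult[symmetric] algebra_simps)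
    qed
  qed (use assms in \<open>auto simp: abs_less_iff\<close>)
  finally show ?thesis .
qed

text \<open>Finitely many maps $x \mapsto q x + \beta_i$ of one ratio $q$, leaving $[lo, hi] \subseteq [0,1]$
invariant, with images of the interval at mutual distance at least $\gamma$.\<close>

locale homogeneous_ifs =
  fixes B :: "'i set" and \<beta> :: "'i \<Rightarrow> real" and q lo hi \<gamma> :: real
  assumes finite_B: "finite B"
    and q: "0 < q" "q < 1"
    and hull: "0 \<le> lo" "lo \<le> hi" "hi \<le> 1"
    and \<gamma>: "0 < \<gamma>"
    and stable: "\<And>i x. i \<in> B \<Longrightarrow> x \<in> {lo..hi} \<Longrightarrow> q * x + \<beta> i \<in> {lo..hi}"
    and gap: "\<And>i j x y. \<lbrakk>i \<in> B; j \<in> B; i \<noteq> j; x \<in> {lo..hi}; y \<in> {lo..hi}\<rbrakk>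
       \<Longrightarrow> \<gamma> \<le> \<bar>(q * x + \<beta> i) - (q * y + \<beta> j)\<bar>"
begin

abbreviation off :: "'i list \<Rightarrow> real" where "off \<equiv> word_offset (\<lambda>_. q) \<beta>"

lemma point_in_hull: "u \<in> words B k \<Longrightarrow> x \<in> {lo..hi} \<Longrightarrow> q ^ k * x + off u \<in> {lo..hi}"
proof (induction k arbitrary: u)
  case (Suc k)
  then obtain i u' where u: "u = i # u'" "i \<in> B" "u' \<in> words B k" by (auto simp: words_Suc)
  have "q * (q ^ k * x + off u') + \<beta> i \<in> {lo..hi}" using Suc u stable by blast
  then show ?case by (simp add: u algebra_simps)
qed simp

lemma abs_off_le: "u \<in> words B k \<Longrightarrow> \<bar>off u\<bar> \<le> 1"
proof -
  assume u: "u \<in> words B k"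
  have "q ^ k * lo + off u \<in> {lo..hi}" using point_in_hull[OF u, of lo] hull by auto
  moreover have "0 \<le> q ^ k * lo" using q hull by simp
  moreover have "q ^ k * lo \<le> 1" using q hull by (intro mult_le_one power_le_one) auto
  ultimately show ?thesis using hull by auto
qed

text \<open>Two words with a common prefix of length $j$ have offsets at a distance comparable to $q^j$.\<close>

lemma off_diff:
  "\<lbrakk>u \<in> words B k; v \<in> words B k\<rbrakk> \<Longrightarrow> \<bar>off u - off v\<bar> \<le> q ^ (k - branch_height u v) \<and>
     (u \<noteq> v \<longrightarrow> \<gamma> * q ^ (k - branch_height u v) \<le> \<bar>off u - off v\<bar>)"
proof (induction k arbitrary: u v)
  case (Suc k)
  then obtain i u' j v' where u: "u = i # u'" "i \<in> B" "u' \<in> words B k"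
    and v: "v = j # v'" "j \<in> B" "v' \<in> words B k" by (auto simp: words_Suc)
  have len: "length u' = k" using u(3) by (simp add: words_def)
  show ?case
  proof (cases "i = j")
    case True
    have "branch_height u' v' \<le> k" using branch_height_le[of u' v'] len by simp
    then have "Suc k - branch_height u v = Suc (k - branch_height u' v')" by (simp add: u v True)
    moreover have "\<bar>off u - off v\<bar> = q * \<bar>off u' - off v'\<bar>"
      using q by (simp add: u v True abs_mult right_diff_distrib[symmetric])
    ultimately show ?thesis using Suc.IH[OF u(3) v(3)] q
      by (auto simp: u v True intro: mult_left_mono)
  next
    case False
    let ?x = "q ^ k * lo + off u'" and ?y = "q ^ k * lo + off v'"
    have J: "?x \<in> {lo..hi}" "?y \<in> {lo..hi}" using point_in_hull u v hull by auto
    have eq: "off u - off v = (q * ?x + \<beta> i) - (q * ?y + \<beta> j)" by (simp add: u v algebra_simps)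
    have "q * ?x + \<beta> i \<in> {lo..hi}" "q * ?y + \<beta> j \<in> {lo..hi}" using stable u v J by blast+
    then have "\<bar>off u - off v\<bar> \<le> 1" unfolding eq using hull by auto
    moreover have "\<gamma> \<le> \<bar>off u - off v\<bar>" unfolding eq using gap[OF u(2) v(2) False J] .
    moreover have "Suc k - branch_height u v = 0" by (simp add: u v False len)
    ultimately show ?thesis by simp
  qed
qed simp

text \<open>The regularity of the offsets: an interval of length of order $q^l$ meets a bounded number of
cylinders of level $l$, each of which has $|B|^{k-l}$ words.\<close>

lemma card_words_near_le:
  fixes R y :: real
  assumes "l \<le> k" "0 \<le> R"
  shows "card {u \<in> words B k. \<bar>off u - y\<bar> \<le> R * q ^ l} \<le> ((2 * R + 2) / \<gamma> + 1) * card B ^ (k - l)"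
proof -
  define S where "S = {u \<in> words B k. \<bar>off u - y\<bar> \<le> R * q ^ l}"
  have fS: "finite S" using finite_B by (simp add: S_def)
  \<comment> \<open>the cylinders of level $l$ met by the interval\<close>
  define T where "T = take l ` S"
  have fT: "finite T" using fS by (simp add: T_def)
  have TW: "T \<subseteq> words B l"
    using assms(1) by (auto simp: T_def S_def words_def dest: in_set_takeD)
  have ql: "0 < q ^ l" using q by simp
  have sep: "\<gamma> * q ^ l \<le> \<bar>off p - off p'\<bar>" if "p \<in> T" "p' \<in> T" "p \<noteq> p'" for p p'
  proof -
    have "\<gamma> * q ^ l \<le> \<gamma> * q ^ (l - branch_height p p')"
      using q \<gamma> by (intro mult_left_mono power_decreasing) auto
    then show ?thesis using off_diff[of p l p'] that TW by force
  qed
  have inj: "inj_on off T"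
  proof (rule inj_onI, rule ccontr)
    fix p p' assume "p \<in> T" "p' \<in> T" "off p = off p'" "p \<noteq> p'"
    then show False using sep[of p p'] ql \<gamma> by (simp add: mult_le_0_iff)
  qed
  have loc: "off p \<in> {y - (R + 1) * q ^ l .. (y - (R + 1) * q ^ l) + (2 * R + 2) * q ^ l}" if "p \<in> T" for p
  proof -
    from that obtain u where u: "u \<in> S" "p = take l u" by (auto simp: T_def)
    have dW: "drop l u \<in> words B (k - l)"
      using u(1) by (auto simp: S_def words_def dest: in_set_dropD)
    have "off u = off (take l u @ drop l u)" by simp
    also have "\<dots> = q ^ l * off (drop l u) + off p"
      unfolding word_offset_append word_ratio_const using u assms(1)
      by (simp add: S_def words_def)
    finally have "off p = off u - q ^ l * off (drop l u)" by simp
    moreover have "\<bar>q ^ l * off (drop l u)\<bar> \<le> q ^ l * 1"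
      unfolding abs_mult using abs_off_le[OF dW] ql by (intro mult_mono) auto
    moreover have "\<bar>off u - y\<bar> \<le> R * q ^ l" using u by (simp add: S_def)
    ultimately have "\<bar>off p - y\<bar> \<le> (R + 1) * q ^ l" by (simp add: algebra_simps)
    then show ?thesis by (auto simp: algebra_simps)
  qed
  have "card T = card (off ` T)" using inj by (simp add: card_image)
  also have "real \<dots> \<le> (2 * R + 2) * q ^ l / (\<gamma> * q ^ l) + 1"
    by (rule card_separated_le[where z = "y - (R + 1) * q ^ l"])
       (use fT loc sep ql \<gamma> assms(2) in \<open>auto simp: zero_le_mult_iff\<close>)
  also have "\<dots> = (2 * R + 2) / \<gamma> + 1" using q by simp
  finally have cT: "card T \<le> (2 * R + 2) / \<gamma> + 1" .
  have fib: "card {u\<in>S. take l u = p} \<le> card B ^ (k - l)" if "p \<in> T" for p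
  proof -
    have "inj_on (drop l) {u\<in>S. take l u = p}"
    proof (rule inj_onI)
      fix u u' assume "u \<in> {u\<in>S. take l u = p}" "u' \<in> {u\<in>S. take l u = p}" "drop l u = drop l u'"
      then show "u = u'" using append_take_drop_id[of l u] append_take_drop_id[of l u'] by simp
    qed
    moreover have "drop l ` {u\<in>S. take l u = p} \<subseteq> words B (k - l)"
      by (auto simp: S_def words_def dest: in_set_dropD)
    ultimately have "card {u\<in>S. take l u = p} \<le> card (words B (k - l))"
      using finite_B by (intro card_inj_on_le) auto
    then show ?thesis by (simp add: card_words finite_B)
  qed
  have "S = (\<Union>p\<in>T. {u\<in>S. take l u = p})" by (auto simp: T_def)
  then have "card S \<le> (\<Sum>p\<in>T. card {u\<in>S. take l u = p})"
    using card_UN_le[OF fT, of "\<lambda>p. {u\<in>S. take l u = p}"] by simp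
  also have "\<dots> \<le> (\<Sum>p\<in>T. card B ^ (k - l))" by (intro sum_mono fib)
  finally have "card S \<le> card T * card B ^ (k - l)" by simp
  then have "real (card S) \<le> real (card T) * real (card B ^ (k - l))"
    unfolding of_nat_mult[symmetric] of_nat_le_iff .
  also have "\<dots> \<le> ((2 * R + 2) / \<gamma> + 1) * card B ^ (k - l)" using cT by (simp add: mult_right_mono)
  finally show ?thesis by (simp add: S_def)
qed

lemma card_times_le:
  fixes M \<rho> :: real
  assumes "0 < \<rho>" "0 \<le> M"
  shows "finite {s::nat. s * \<rho> \<le> M}" "card {s::nat. s * \<rho> \<le> M} \<le> M / \<rho> + 1"
proof -
  have sub: "{s::nat. s * \<rho> \<le> M} \<subseteq> {..nat \<lfloor>M / \<rho>\<rfloor>}"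
    using assms by (auto simp: le_nat_floor field_simps)
  then show "finite {s::nat. s * \<rho> \<le> M}" using finite_subset by blast
  have "card {s::nat. s * \<rho> \<le> M} \<le> card {..nat \<lfloor>M / \<rho>\<rfloor>}" using sub by (intro card_mono) auto
  moreover have "real (nat \<lfloor>M / \<rho>\<rfloor>) \<le> M / \<rho>" using assms by (intro of_nat_floor) auto
  ultimately show "card {s::nat. s * \<rho> \<le> M} \<le> M / \<rho> + 1" by simp
qed

text \<open>Transversality. For fixed $u, v, v'$ let $e = $ \<open>branch_height v v'\<close>. As the offsets of $v$ and $v'$
differ by an amount of order at most $q^{k-e}$, the condition forces the offsets of $u$ and $u'$ to do so too, which
leaves of order $|B|^e$ words $u'$. For $v \ne v'$ the difference is also bounded below by this
order, so that each $u'$ satisfies the condition for a proportion of order $q^e$ of the parameters $s\rho \le M$.\<close>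

lemma sum_pairs_near_le:
  fixes h \<rho> M :: real
  assumes u: "u \<in> words B k" and v: "v \<in> words B k" "v' \<in> words B k"
    and h: "0 < h" "h \<le> q ^ Suc k" and \<rho>: "0 < \<rho>" "\<rho> \<le> q ^ k" and M: "0 \<le> M"
  defines "e \<equiv> branch_height v v'"
  shows "(\<Sum>u'\<in>words B k. real (card {s::nat. s * \<rho> \<le> M \<and>
             \<bar>q * (off u - off u') + s * \<rho> * (q * (off v - off v'))\<bar> < h}))
     \<le> (((2 * M + 4) / \<gamma> + 1) * (2 / \<gamma> + M + 1) / \<rho>) * (card B * q) ^ e"
proof -
  let ?S = "{s::nat. s * \<rho> \<le> M}"
  note S = card_times_le[OF \<rho>(1) M]
  let ?n = "\<lambda>u'. card {s::nat. s * \<rho> \<le> M \<and> \<bar>q * (off u - off u') + s * \<rho> * (q * (off v - off v'))\<bar> < h}"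
  let ?U = "{u' \<in> words B k. \<bar>off u' - off u\<bar> \<le> (1 + M) * q ^ (k - e)}"
  have ek: "e \<le> k" using branch_height_le[of v v'] v(1) by (simp add: e_def words_def)
  have qe: "q ^ Suc k = q ^ e * (q * q ^ (k - e))" using ek
    by (metis le_add_diff_inverse mult.left_commute power_Suc power_add)
  have qe1: "q ^ e \<le> 1" using q by (simp add: power_le_one)
  have qp: "0 < q ^ (k - e)" "0 < q ^ e" using q by auto
  have off_v: "\<bar>off v - off v'\<bar> \<le> q ^ (k - e)" using off_diff[OF v] by (simp add: e_def)
  have zero: "?n u' = 0" if u': "u' \<in> words B k - ?U" for u'
  proof -
    have far: "(1 + M) * q ^ (k - e) < \<bar>off u - off u'\<bar>" using u' by (auto simp: abs_minus_commute)
    have "h \<le> \<bar>q * (off u - off u') + s * \<rho> * (q * (off v - off v'))\<bar>" if s: "s * \<rho> \<le> M" for s :: nat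
    proof -
      have "\<bar>s * \<rho> * (q * (off v - off v'))\<bar> = (s * \<rho>) * (q * \<bar>off v - off v'\<bar>)"
        using \<rho> q by (simp add: abs_mult)
      also have "\<dots> \<le> M * (q * q ^ (k - e))"
        using s \<rho> q off_v M by (intro mult_mono) auto
      finally have 1: "\<bar>s * \<rho> * (q * (off v - off v'))\<bar> \<le> M * (q * q ^ (k - e))" .
      have "\<bar>q * (off u - off u')\<bar> = q * \<bar>off u - off u'\<bar>" using q by (simp add: abs_mult)
      also have "\<dots> \<ge> q * ((1 + M) * q ^ (k - e))" using far q by (intro mult_left_mono) auto
      finally have 2: "\<bar>q * (off u - off u')\<bar> \<ge> q * q ^ (k - e) + M * (q * q ^ (k - e))"
        by (simp add: algebra_simps)
      have "h \<le> q ^ e * (q * q ^ (k - e))" using h(2) unfolding qe .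
      also have "\<dots> \<le> 1 * (q * q ^ (k - e))" using qe1 q qp by (intro mult_right_mono) auto
      finally have "h \<le> 1 * (q * q ^ (k - e))" .
      with 1 2 show ?thesis by linarith
    qed
    then have "{s::nat. s * \<rho> \<le> M \<and> \<bar>q * (off u - off u') + s * \<rho> * (q * (off v - off v'))\<bar> < h} = {}"
      by force
    then show ?thesis by (simp only: card.empty)
  qed
  have each: "?n u' \<le> (2 / \<gamma> + M + 1) * q ^ e / \<rho>" for u'
  proof (cases "v = v'")
    case True
    then have "e = 0" unfolding e_def by (induction v arbitrary: v') auto
    have "?n u' \<le> card ?S" using S(1) by (intro card_mono) auto
    then have "?n u' \<le> M / \<rho> + 1" using S(2) by linarith
    also have "\<dots> \<le> (2 / \<gamma> + M + 1) * q ^ e / \<rho>"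
    proof -
      have "\<rho> \<le> 1" using \<rho>(2) q power_le_one[of q k] by simp
      then have "1 \<le> 1 / \<rho>" using \<rho> by simp
      moreover have "0 \<le> 2 / \<gamma> / \<rho>" using \<rho> \<gamma> by simp
      moreover have "(2 / \<gamma> + M + 1) * q ^ e / \<rho> = 2 / \<gamma> / \<rho> + M / \<rho> + 1 / \<rho>"
        by (simp add: \<open>e = 0\<close> add_divide_distrib)
      ultimately show ?thesis by linarith
    qed
    finally show ?thesis .
  next
    case False
    let ?\<delta> = "\<rho> * (q * (off v - off v'))"
    have low: "\<gamma> * q ^ (k - e) \<le> \<bar>off v - off v'\<bar>" using off_diff[OF v] False by (simp add: e_def)
    moreover have "0 < \<gamma> * q ^ (k - e)" using \<gamma> qp by simp
    ultimately have "off v - off v' \<noteq> 0" by linarith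
    then have "?\<delta> \<noteq> 0" using \<rho> q by simp
    then have "real (card {s\<in>?S. \<bar>q * (off u - off u') + s * ?\<delta>\<bar> < h}) \<le> 2 * h / \<bar>?\<delta>\<bar> + 1"
      using S(1) h(1) by (intro card_times_near_le) auto
    then have "?n u' \<le> 2 * h / \<bar>?\<delta>\<bar> + 1" by (simp add: mult.assoc)
    also have "2 * h / \<bar>?\<delta>\<bar> \<le> 2 * q ^ Suc k / (\<rho> * (q * (\<gamma> * q ^ (k - e))))"
    proof (rule frac_le)
      have "\<rho> * (q * (\<gamma> * q ^ (k - e))) \<le> \<rho> * (q * \<bar>off v - off v'\<bar>)"
        using low \<rho> q by (intro mult_left_mono) auto
      also have "\<dots> = \<bar>?\<delta>\<bar>" using \<rho> q by (simp add: abs_mult)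
      finally show "\<rho> * (q * (\<gamma> * q ^ (k - e))) \<le> \<bar>?\<delta>\<bar>" .
    qed (use h \<rho> q \<gamma> qp in auto)
    also have "2 * q ^ Suc k / (\<rho> * (q * (\<gamma> * q ^ (k - e)))) = 2 / \<gamma> * q ^ e / \<rho>"
      unfolding qe using q qp by (simp add: field_simps)
    also have "2 / \<gamma> * q ^ e / \<rho> + 1 \<le> (2 / \<gamma> + M + 1) * q ^ e / \<rho>"
    proof -
      have "q ^ k \<le> q ^ e" using q ek by (intro power_decreasing) auto
      then have "1 \<le> q ^ e / \<rho>" using \<rho> by simp
      moreover have "0 \<le> M * q ^ e / \<rho>" using M \<rho> qp by simp
      ultimately show ?thesis by (simp add: add_divide_distrib algebra_simps)
    qed
    finally show ?thesis by simp
  qed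
  have fU: "finite ?U" using finite_B by simp
  have "(\<Sum>u'\<in>words B k. real (?n u')) = (\<Sum>u'\<in>?U. real (?n u'))"
    using zero finite_B by (intro sum.mono_neutral_right) auto
  also have "\<dots> \<le> (\<Sum>u'\<in>?U. (2 / \<gamma> + M + 1) * q ^ e / \<rho>)" by (intro sum_mono each)
  also have "\<dots> = card ?U * ((2 / \<gamma> + M + 1) * q ^ e / \<rho>)" by simp
  also have "\<dots> \<le> (((2 * (1 + M) + 2) / \<gamma> + 1) * card B ^ (k - (k - e))) * ((2 / \<gamma> + M + 1) * q ^ e / \<rho>)"
    using M \<gamma> qp \<rho> by (intro mult_right_mono card_words_near_le) auto
  also have "\<dots> = (((2 * M + 4) / \<gamma> + 1) * (2 / \<gamma> + M + 1) / \<rho>) * (card B * q) ^ e"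
    using ek by (simp add: power_mult_distrib field_simps)
  finally show ?thesis .
qed

end

section \<open>The energy estimate and good parameters\<close>

lemma geometric_sum_le:
  fixes \<sigma> :: real
  assumes "1 < \<sigma>"
  shows "(\<Sum>j\<le>k. \<sigma> ^ j) \<le> \<sigma> / (\<sigma> - 1) * \<sigma> ^ k"
proof -
  have "(\<Sum>j\<le>k. \<sigma> ^ j) = (\<sigma> ^ Suc k - 1) / (\<sigma> - 1)"
    using assms by (simp only: lessThan_Suc_atMost[symmetric]) (rule geometric_sum, simp)
  also have "\<dots> \<le> \<sigma> ^ Suc k / (\<sigma> - 1)" using assms by (intro divide_right_mono) auto
  finally show ?thesis by simp
qed

context homogeneous_ifs
begin

text \<open>The growth rate $\sigma = |B|^2 q$. It exceeds $1$ exactly when the similarity dimension exceeds $1/2$.\<close>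

definition "\<sigma> = (card B)\<^sup>2 * q"

text \<open>The constant in the energy estimate below.\<close>

definition "C0 M = ((2 * M + 4) / \<gamma> + 1) * (2 / \<gamma> + M + 1) * (\<sigma> / (\<sigma> - 1))"

text \<open>The energy estimate, summed over the grid of parameters $r = s\rho \le M$. The constants $x_0, y_0$ cancel in
all differences.\<close>

lemma energy_sum_le:
  fixes h \<rho> M x0 y0 :: real
  assumes h: "0 < h" "h \<le> q ^ Suc k" and \<rho>: "0 < \<rho>" "\<rho> \<le> q ^ k" and M: "0 \<le> M"
    and \<sigma>: "1 < \<sigma>"
  defines "W \<equiv> words B k"
  defines "z \<equiv> \<lambda>s::nat. \<lambda>(u, v). (q * off u + x0) + s * \<rho> * (q * off v + y0)"
  shows "(\<Sum>s\<in>{s::nat. s * \<rho> \<le> M}.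
            real (card {(p, p'). p \<in> W \<times> W \<and> p' \<in> W \<times> W \<and> \<bar>z s p - z s p'\<bar> < h}))
     \<le> C0 M / \<rho> * ((real (card W))\<^sup>2 * \<sigma> ^ k)"
proof -
  let ?S = "{s::nat. s * \<rho> \<le> M}"
  let ?D = "((2 * M + 4) / \<gamma> + 1) * (2 / \<gamma> + M + 1) / \<rho>"
  have D0: "0 \<le> ?D" using M \<gamma> \<rho> by simp
  have fW: "finite W" using finite_B by (simp add: W_def)
  have fS: "finite ?S" using card_times_le[OF \<rho>(1) M] by simp
  let ?c = "\<lambda>s u v u' v'. \<bar>q * (off u - off u') + real s * \<rho> * (q * (off v - off v'))\<bar> < h"
  have zz: "\<bar>z s (u, v) - z s (u', v')\<bar> = \<bar>q * (off u - off u') + real s * \<rho> * (q * (off v - off v'))\<bar>"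
    for s u v u' v' by (simp add: z_def algebra_simps)
  have 1: "real (card {(p, p'). p \<in> W \<times> W \<and> p' \<in> W \<times> W \<and> \<bar>z s p - z s p'\<bar> < h})
      = (\<Sum>u\<in>W. \<Sum>v\<in>W. \<Sum>v'\<in>W. \<Sum>u'\<in>W. of_bool (?c s u v u' v'))" for s
  proof -
    have "{(p, p'). p \<in> W \<times> W \<and> p' \<in> W \<times> W \<and> \<bar>z s p - z s p'\<bar> < h}
        = ((W \<times> W) \<times> (W \<times> W)) \<inter> {x. \<bar>z s (fst x) - z s (snd x)\<bar> < h}" by auto
    then have "real (card {(p, p'). p \<in> W \<times> W \<and> p' \<in> W \<times> W \<and> \<bar>z s p - z s p'\<bar> < h})
        = (\<Sum>x\<in>(W \<times> W) \<times> (W \<times> W). of_bool (\<bar>z s (fst x) - z s (snd x)\<bar> < h))"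
      using fW by (simp add: sum_of_bool_eq)
    also have "\<dots> = (\<Sum>p\<in>W \<times> W. \<Sum>p'\<in>W \<times> W. of_bool (\<bar>z s p - z s p'\<bar> < h))"
      by (simp add: sum.cartesian_product case_prod_unfold)
    also have "\<dots> = (\<Sum>u\<in>W. \<Sum>v\<in>W. \<Sum>u'\<in>W. \<Sum>v'\<in>W. of_bool (\<bar>z s (u, v) - z s (u', v')\<bar> < h))"
      by (simp add: sum.cartesian_product')
    also have "\<dots> = (\<Sum>u\<in>W. \<Sum>v\<in>W. \<Sum>v'\<in>W. \<Sum>u'\<in>W. of_bool (?c s u v u' v'))"
      unfolding zz by (intro sum.cong refl sum.swap)
    finally show ?thesis .
  qed
  have "(\<Sum>s\<in>?S. real (card {(p, p'). p \<in> W \<times> W \<and> p' \<in> W \<times> W \<and> \<bar>z s p - z s p'\<bar> < h}))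
      = (\<Sum>s\<in>?S. \<Sum>u\<in>W. \<Sum>v\<in>W. \<Sum>v'\<in>W. \<Sum>u'\<in>W. of_bool (?c s u v u' v'))"
    by (intro sum.cong refl 1)
  also have "\<dots> = (\<Sum>u\<in>W. \<Sum>v\<in>W. \<Sum>v'\<in>W. \<Sum>u'\<in>W. \<Sum>s\<in>?S. of_bool (?c s u v u' v'))"
    \<comment> \<open>the sum over $s$ is moved inwards past the four word sums\<close>
    by (subst sum.swap, rule sum.cong[OF refl])+ (rule refl)
  also have "\<dots> \<le> (\<Sum>u\<in>W. \<Sum>v\<in>W. \<Sum>v'\<in>W. ?D * (card B * q) ^ branch_height v v')"
  proof (intro sum_mono)
    fix u v v' assume "u \<in> W" "v \<in> W" "v' \<in> W"
    then have "(\<Sum>u'\<in>W. real (card {s::nat. s * \<rho> \<le> M \<and> ?c s u v u' v'})) \<le> ?D * (card B * q) ^ branch_height v v'"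
      unfolding W_def by (intro sum_pairs_near_le h \<rho> M)
    moreover have "(\<Sum>s\<in>?S. of_bool (?c s u v u' v')) = real (card {s::nat. s * \<rho> \<le> M \<and> ?c s u v u' v'})" for u'
      using fS by (simp add: sum_of_bool_eq Collect_conj_eq)
    ultimately show "(\<Sum>u'\<in>W. \<Sum>s\<in>?S. of_bool (?c s u v u' v')) \<le> ?D * (card B * q) ^ branch_height v v'"
      by simp
  qed
  also have "\<dots> \<le> (\<Sum>u\<in>W. \<Sum>v\<in>W. ?D * (\<sigma> / (\<sigma> - 1) * \<sigma> ^ k))"
  proof (intro sum_mono)
    fix u v assume v: "v \<in> W"
    have "(\<Sum>v'\<in>W. (card B * q) ^ branch_height v v') \<le> (\<Sum>j\<le>k. (card B * (card B * q)) ^ j)"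
      using v q unfolding W_def by (intro sum_branch_height finite_B) auto
    also have "\<dots> = (\<Sum>j\<le>k. \<sigma> ^ j)" by (simp add: \<sigma>_def power2_eq_square mult.assoc)
    also have "\<dots> \<le> \<sigma> / (\<sigma> - 1) * \<sigma> ^ k" using \<sigma> by (rule geometric_sum_le)
    finally show "(\<Sum>v'\<in>W. ?D * (card B * q) ^ branch_height v v') \<le> ?D * (\<sigma> / (\<sigma> - 1) * \<sigma> ^ k)"
      unfolding sum_distrib_left[symmetric] using D0 by (intro mult_left_mono) auto
  qed
  also have "\<dots> = C0 M / \<rho> * ((real (card W))\<^sup>2 * \<sigma> ^ k)"
    by (simp add: C0_def power2_eq_square mult_ac)
  finally show ?thesis .
qed

end

text \<open>The data of one perturbation step. The words $\alpha u$ with $u \in B^k$ are to be moved by at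
most $\tau\lambda$, while the words $\omega v$ stay fixed. The number $\eta$ is the length of the cells
relative to $\lambda$: the bound by $\tau/16$ keeps the displacements needed below $\tau\lambda$, and the bound by
$\gamma/(2M)$ separates the points $r Y_v$ for $r \ge 1/(2M)$. The last assumption holds
for large $k$.\<close>

locale perturbed_sum = homogeneous_ifs +
  fixes \<alpha> \<omega> :: 'a and M \<tau> \<epsilon> \<eta> :: real and k :: nat
  assumes letters: "\<alpha> \<in> B" "\<omega> \<in> B"
    and M: "1 \<le> M" and \<tau>: "0 < \<tau>" "\<tau> \<le> 1" and \<epsilon>: "0 < \<epsilon>"
    and \<sigma>: "1 < \<sigma>"
    and \<eta>: "0 < \<eta>" "\<eta> \<le> \<tau> / 16" "\<eta> \<le> \<gamma> / (2 * M)"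
    and small: "q ^ Suc k * (4 + M) \<le> \<tau> / 8"
begin

text \<open>The scale \<open>lam\<close> $= \lambda$, the cell length $h$ and the mesh $\rho = \lambda h$ of the grid of parameters $r$.
The window consists of $H$ cells, hence has length about $\tau/4$. The translations are
$t_u = \lambda h j_u$ with integers $|j_u| \le J$. The constant $C_w$ bounds the number of windows
needed to cover all points $X_u + r Y_v$. The energy of $r$ is the number of
pairs of points $X_u + r Y_v$ at distance below $h$. A parameter is good if its energy is at most
$C_E |W|^4 \lambda$, and $p_0$ bounds below the probability that one random translation hits its target.
Neither $C_w$, $C_E$ nor $p_0$ depends on $k$.\<close>

definition "lam = q ^ Suc k"
definition "h = \<eta> * lam"
definition "\<rho> = lam * h"
definition "W = words B k"
definition "X u = off (\<alpha> # u)"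
definition "Y v = off (\<omega> # v)"
definition "H = nat \<lceil>\<tau> / (4 * h)\<rceil>"
definition "J = \<lfloor>\<tau> / h\<rfloor>"
definition "Cw = 8 * (1 + M) / \<tau> + 2"
definition "CE = 2 * C0 M / (q * \<epsilon>)"
definition "p0 = \<eta> / (12 * Cw\<^sup>2 * CE)"
definition "energy r = real (card {(p, p'). p \<in> W \<times> W \<and> p' \<in> W \<times> W \<and>
   \<bar>(X (fst p) + r * Y (snd p)) - (X (fst p') + r * Y (snd p'))\<bar> < h})"
definition "good r \<longleftrightarrow> energy r \<le> CE * (real (card W) ^ 4 * lam)"

lemma lam: "0 < lam" "lam \<le> 1" "lam * (4 + M) \<le> \<tau> / 8"
  using q small by (auto simp: lam_def intro!: mult_le_one power_le_one)

lemma h: "0 < h" "h \<le> lam" "h \<le> \<eta>" "h \<le> 1"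
proof -
  have "\<eta> \<le> 1" using \<eta> \<tau> by simp
  then show "0 < h" "h \<le> lam" "h \<le> \<eta>"
    using lam \<eta> by (auto simp: h_def mult_le_cancel_right1 mult_le_cancel_left1)
  then show "h \<le> 1" using \<open>\<eta> \<le> 1\<close> by simp
qed

lemma \<rho>: "0 < \<rho>" "\<rho> \<le> h" "\<rho> \<le> q ^ k"
proof -
  show "0 < \<rho>" "\<rho> \<le> h" using lam h by (auto simp: \<rho>_def mult_le_cancel_right1)
  then have "\<rho> \<le> lam" using h by simp
  also have "\<dots> \<le> q ^ k" using q by (simp add: lam_def mult_le_cancel_right1)
  finally show "\<rho> \<le> q ^ k" .
qed

lemma finite_W [simp]: "finite W"
  using finite_B by (simp add: W_def)

lemma card_W: "card W = card B ^ k"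
  using finite_B by (simp add: W_def card_words)

lemma W_pos: "0 < card W"
  unfolding card_W using letters finite_B by (auto simp: card_gt_0_iff)

lemma card_W_sq: "(real (card W))\<^sup>2 * lam = q * \<sigma> ^ k"
proof -
  have "(real (card W))\<^sup>2 = (real (card B) ^ 2) ^ k" by (simp add: card_W power_mult[symmetric] mult.commute)
  then show ?thesis by (simp add: lam_def \<sigma>_def power_mult_distrib)
qed

lemma XY_le: "u \<in> W \<Longrightarrow> \<bar>X u\<bar> \<le> 1" "u \<in> W \<Longrightarrow> \<bar>Y u\<bar> \<le> 1"
  unfolding X_def Y_def
  by (rule abs_off_le[of _ "Suc k"], use letters in \<open>simp add: W_def words_Cons_iff\<close>)+

lemma C0_pos: "0 < C0 M"
  unfolding C0_def using M \<gamma> \<sigma> by (intro mult_pos_pos add_pos_pos divide_pos_pos) auto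

lemma consts_pos: "0 < Cw" "0 < CE" "0 < p0"
proof -
  show Cw: "0 < Cw" unfolding Cw_def using M \<tau> by (intro add_pos_pos divide_pos_pos) auto
  show CE: "0 < CE" unfolding CE_def using C0_pos q \<epsilon> by simp
  show "0 < p0" unfolding p0_def using Cw CE \<eta> by simp
qed

lemma H: "0 < H" "\<tau> / 4 \<le> H * h" "H * h \<le> \<tau> / 4 + h" "H \<le> 2 / h"
proof -
  have x: "0 < \<tau> / (4 * h)" using \<tau> h by simp
  then show H0: "0 < H" by (simp add: H_def)
  have H1: "\<tau> / (4 * h) \<le> H" "H < \<tau> / (4 * h) + 1" using x by (auto simp: H_def) linarith
  then show 1: "\<tau> / 4 \<le> H * h" using h by (simp add: field_simps)
  have "H * h \<le> (\<tau> / (4 * h) + 1) * h" using H1 h by (intro mult_right_mono) auto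
  also have "\<dots> = \<tau> / 4 + h" using h by (simp add: field_simps)
  finally show 2: "H * h \<le> \<tau> / 4 + h" .
  then have "H * h \<le> 2" using \<tau> h by simp
  then show "H \<le> 2 / h" using h by (simp add: field_simps)
qed

lemma J: "0 \<le> J" "J * h \<le> \<tau>" "\<tau> / h - 1 < J" "card {-J..J} \<le> 3 / h"
proof -
  have x: "0 < \<tau> / h" using \<tau> h by simp
  then show J0: "0 \<le> J" by (simp add: J_def)
  show "\<tau> / h - 1 < J" unfolding J_def by linarith
  have "J \<le> \<tau> / h" by (simp add: J_def)
  then show Jh: "J * h \<le> \<tau>" using h by (simp add: field_simps)
  have "real (card {-J..J}) = 2 * J + 1" using J0 by simp
  moreover have "J \<le> 1 / h" "1 \<le> 1 / h" using Jh \<tau> h by (auto simp: field_simps)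
  ultimately show "card {-J..J} \<le> 3 / h" by simp
qed

lemma sum_energy_le:
  "(\<Sum>s\<in>{s::nat. s * \<rho> \<le> M}. energy (s * \<rho>)) \<le> C0 M / \<rho> * ((real (card W))\<^sup>2 * \<sigma> ^ k)"
proof -
  have "(\<Sum>s\<in>{s::nat. s * \<rho> \<le> M}. energy (s * \<rho>)) =
      (\<Sum>s\<in>{s::nat. s * \<rho> \<le> M}. real (card {(p, p'). p \<in> words B k \<times> words B k \<and> p' \<in> words B k \<times> words B k \<and>
         \<bar>(\<lambda>(u, v). (q * off u + \<beta> \<alpha>) + s * \<rho> * (q * off v + \<beta> \<omega>)) p -
          (\<lambda>(u, v). (q * off u + \<beta> \<alpha>) + s * \<rho> * (q * off v + \<beta> \<omega>)) p'\<bar> < h}))"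
    by (simp add: energy_def W_def X_def Y_def case_prod_unfold)
  also have "\<dots> \<le> C0 M / \<rho> * ((real (card (words B k)))\<^sup>2 * \<sigma> ^ k)"
    by (rule energy_sum_le) (use h \<rho> M \<sigma> in \<open>auto simp: lam_def\<close>)
  finally show ?thesis by (simp add: W_def)
qed

lemma card_bad_le: "card {s::nat. s * \<rho> \<le> M \<and> \<not> good (s * \<rho>)} * \<rho> \<le> \<epsilon> / 2"
proof -
  let ?S = "{s::nat. s * \<rho> \<le> M}" and ?B = "{s::nat. s * \<rho> \<le> M \<and> \<not> good (s * \<rho>)}"
  let ?N = "real (card W)"
  have fS: "finite ?S" using card_times_le(1)[OF \<rho>(1)] M by simp
  have N4: "?N ^ 4 * lam = ?N\<^sup>2 * (q * \<sigma> ^ k)"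
    unfolding card_W_sq[symmetric] by (simp add: power2_eq_square power4_eq_xxxx)
  have pos: "0 < ?N\<^sup>2 * \<sigma> ^ k" using W_pos \<sigma> by (intro mult_pos_pos zero_less_power) auto
  have "card ?B * (CE * (?N ^ 4 * lam)) = (\<Sum>s\<in>?B. CE * (?N ^ 4 * lam))" by simp
  also have "\<dots> \<le> (\<Sum>s\<in>?B. energy (s * \<rho>))" by (intro sum_mono) (auto simp: good_def)
  also have "\<dots> \<le> (\<Sum>s\<in>?S. energy (s * \<rho>))"
    using fS by (intro sum_mono2) (auto simp: energy_def)
  also have "\<dots> \<le> C0 M / \<rho> * (?N\<^sup>2 * \<sigma> ^ k)" by (rule sum_energy_le)
  finally have "(card ?B * CE * q) * (?N\<^sup>2 * \<sigma> ^ k) \<le> C0 M / \<rho> * (?N\<^sup>2 * \<sigma> ^ k)"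
    unfolding N4 by (simp add: mult.assoc mult.left_commute)
  then have "card ?B * CE * q \<le> C0 M / \<rho>" by (rule mult_right_le_imp_le[OF _ pos])
  then have "card ?B * \<rho> * (CE * q) \<le> C0 M" using \<rho> by (simp add: field_simps)
  then have "card ?B * \<rho> \<le> C0 M / (CE * q)" using consts_pos q by (simp add: field_simps)
  also have "\<dots> = \<epsilon> / 2" using C0_pos q \<epsilon> by (simp add: CE_def)
  finally show ?thesis .
qed

text \<open>At a good parameter the window at $a$ contains a set $Q$ of well filled cells. Their number is proportional to
$1/\lambda$, so they make up a fixed proportion of the $2J + 1$ admissible translations. A filled cell is met
by many different $u$, since $r|Y_v - Y_{v'}| \ge h$ forbids two points of the cell with the same $u$.\<close>

lemma good_ratio:
  assumes r: "1 / (2 * M) \<le> r" "r \<le> M" and "good r"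
  shows "\<exists>a Q. \<bar>a\<bar> \<le> 4 + M \<and> Q \<subseteq> {0..<int H} \<and> p0 * card {-J..J} \<le> card Q \<and>
      (\<forall>i\<in>Q. \<eta> * q / (4 * Cw) * \<sigma> ^ k \<le> card {u\<in>W. \<exists>v\<in>W. \<lfloor>(X u + r * Y v - a) / h\<rfloor> = i})"
proof -
  let ?N = "real (card W)"
  let ?z = "\<lambda>p. X (fst p) + r * Y (snd p)"
  have "0 < 1 / (2 * M)" using M by simp
  then have r0: "0 < r" using r by linarith
  have "\<exists>a Q. \<bar>a\<bar> \<le> (1 + M) + H * h \<and> Q \<subseteq> {0..<int H} \<and>
     (card (W \<times> W) / (2 * Cw))\<^sup>2 \<le> card Q * (CE * (?N ^ 4 * lam)) \<and>
     (\<forall>i\<in>Q. card (W \<times> W) / (2 * Cw * H) \<le> card {p\<in>W \<times> W. \<lfloor>(?z p - a) / h\<rfloor> = i})"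
  proof (rule dense_window)
    show "\<bar>?z p\<bar> \<le> 1 + M" if "p \<in> W \<times> W" for p
    proof -
      have "\<bar>X (fst p)\<bar> \<le> 1" "\<bar>Y (snd p)\<bar> \<le> 1" using XY_le that by auto
      moreover from this have "\<bar>r\<bar> * \<bar>Y (snd p)\<bar> \<le> M * 1"
        using r r0 M by (intro mult_mono) auto
      ultimately show ?thesis unfolding abs_mult[symmetric] by linarith
    qed
    have "2 * (1 + M) / (H * h) \<le> 2 * (1 + M) / (\<tau> / 4)"
      using H M \<tau> by (intro divide_left_mono) (auto intro!: mult_pos_pos h)
    then show "2 * (1 + M) / (H * h) + 2 \<le> Cw" by (simp add: Cw_def)
    show "card {(p, p'). p \<in> W \<times> W \<and> p' \<in> W \<times> W \<and> \<bar>?z p - ?z p'\<bar> < h} \<le> CE * (?N ^ 4 * lam)"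
      using \<open>good r\<close> by (simp add: good_def energy_def)
  qed (use M h H in auto)
  then obtain a Q where a: "\<bar>a\<bar> \<le> (1 + M) + H * h" and Q: "Q \<subseteq> {0..<int H}"
    and cQ: "(card (W \<times> W) / (2 * Cw))\<^sup>2 \<le> card Q * (CE * (?N ^ 4 * lam))"
    and nQ: "\<And>i. i \<in> Q \<Longrightarrow> card (W \<times> W) / (2 * Cw * H) \<le> card {p\<in>W \<times> W. \<lfloor>(?z p - a) / h\<rfloor> = i}"
    by blast
  have "H * h \<le> 2" using H(3) \<tau> h by simp
  then have a': "\<bar>a\<bar> \<le> 4 + M" using a by simp
  have "?N ^ 4 * (1 / (4 * Cw\<^sup>2)) = (card (W \<times> W) / (2 * Cw))\<^sup>2"
    by (simp add: card_cartesian_product power_divide power_mult_distrib power2_eq_square power4_eq_xxxx)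
  also have "\<dots> \<le> ?N ^ 4 * (card Q * (CE * lam))" using cQ by (simp add: mult_ac)
  finally have "1 / (4 * Cw\<^sup>2) \<le> card Q * (CE * lam)"
    by (rule mult_left_le_imp_le) (use W_pos in \<open>intro zero_less_power; simp only: of_nat_0_less_iff\<close>)
  then have cQ': "1 / (4 * Cw\<^sup>2 * CE * lam) \<le> card Q" using consts_pos lam by (simp add: field_simps)
  have "p0 * card {-J..J} \<le> p0 * (3 / h)" using J consts_pos by (intro mult_left_mono) auto
  also have "\<dots> = 1 / (4 * Cw\<^sup>2 * CE * lam)" using \<eta> lam by (simp add: p0_def h_def field_simps)
  finally have pQ: "p0 * card {-J..J} \<le> card Q" using cQ' by linarith
  have "\<eta> * q / (4 * Cw) * \<sigma> ^ k \<le> card {u\<in>W. \<exists>v\<in>W. \<lfloor>(X u + r * Y v - a) / h\<rfloor> = i}" if i: "i \<in> Q" for i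
  proof -
    let ?F = "{p\<in>W \<times> W. \<lfloor>(?z p - a) / h\<rfloor> = i}"
    have inj: "inj_on fst ?F"
    proof (rule inj_onI, rule ccontr)
      fix p p' assume p: "p \<in> ?F" "p' \<in> ?F" "fst p = fst p'" "p \<noteq> p'"
      obtain u v v' where uv: "p = (u, v)" "p' = (u, v')" "u \<in> W" "v \<in> W" "v' \<in> W" "v \<noteq> v'"
        using p by (cases p; cases p') auto
      have "\<bar>(?z p - a) / h - (?z p' - a) / h\<bar> < 1" using p(1,2) by simp linarith
      also have "(?z p - a) / h - (?z p' - a) / h = r * (Y v - Y v') / h"
        by (simp add: uv diff_divide_distrib[symmetric] algebra_simps)
      finally have "\<bar>r * (Y v - Y v')\<bar> < h" using h(1) by (simp add: abs_divide)
      then have lt: "r * \<bar>Y v - Y v'\<bar> < h" unfolding abs_mult using r0 by simp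
      have len: "length v = k" "length v' = k" using uv by (auto simp: W_def words_def)
      have "k - branch_height v v' \<le> k - 1" using branch_height_pos[of v v'] len uv by simp
      then have "q ^ k \<le> q * q ^ (k - branch_height v v')"
        using branch_height_pos[of v v'] branch_height_le[of v v'] len uv q
        unfolding power_Suc[symmetric] by (intro power_decreasing) auto
      then have "\<gamma> * q ^ k \<le> q * (\<gamma> * q ^ (k - branch_height v v'))"
        using \<gamma> by (simp add: mult.left_commute)
      also have "\<dots> \<le> q * \<bar>off v - off v'\<bar>"
        using off_diff[of v k v'] uv q by (intro mult_left_mono) (auto simp: W_def)
      also have "\<dots> = \<bar>Y v - Y v'\<bar>" using q by (simp add: Y_def abs_mult right_diff_distrib[symmetric])
      finally have "1 / (2 * M) * (\<gamma> * q ^ k) \<le> r * \<bar>Y v - Y v'\<bar>"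
        using r r0 \<gamma> q by (intro mult_mono) auto
      moreover have "h \<le> \<gamma> / (2 * M) * q ^ k"
      proof -
        have "lam \<le> q ^ k" using q by (simp add: lam_def mult_le_cancel_right1)
        then show ?thesis unfolding h_def using \<eta> lam \<gamma> M by (intro mult_mono) auto
      qed
      ultimately show False using lt by simp
    qed
    have "\<eta> * q / (4 * Cw) * \<sigma> ^ k = ?N\<^sup>2 * h / (4 * Cw)"
      using card_W_sq by (simp add: h_def mult_ac)
    also have "\<dots> \<le> ?N\<^sup>2 / (2 * Cw * H)"
    proof -
      have "H * h \<le> 2" by fact
      then have "?N\<^sup>2 * (H * h) \<le> ?N\<^sup>2 * 2" by (intro mult_left_mono) auto
      then show ?thesis using consts_pos H(1) by (simp add: field_simps)
    qed
    also have "\<dots> = card (W \<times> W) / (2 * Cw * H)" by (simp add: card_cartesian_product power2_eq_square)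
    also have "\<dots> \<le> card ?F" by (rule nQ[OF i])
    also have "card ?F = card (fst ` ?F)" using inj by (simp add: card_image)
    also have "fst ` ?F = {u\<in>W. \<exists>v\<in>W. \<lfloor>(X u + r * Y v - a) / h\<rfloor> = i}" by force
    finally show ?thesis .
  qed
  with a' Q pQ show ?thesis by blast
qed

end

section \<open>Random translations\<close>

context perturbed_sum
begin

text \<open>The renormalisation of the grid point $x = a + \lambda a + \lambda h y$ by the unperturbed pair $(u, v)$,
expressed as the index of a cell of length $h$ counted from $a + \lambda a$. Perturbing
by $t_u = \lambda h j$ subtracts exactly $j$ from the index.\<close>

definition "renorm_index a r y u v = \<lfloor>((a + lam * a + lam * h * y - X u - r * Y v) / lam - a - lam * a) / h\<rfloor>"

lemma renorm_eq:
  "((a + lam * a + lam * h * y - X u - r * Y v) / lam - a - lam * a) / h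
     = (lam * y - (X u + r * Y v - a) / h) / lam - a / \<eta>"
  using lam h \<eta> by (simp add: h_def field_simps)

text \<open>The shift by $\lambda a$ makes $x = a + \lambda a + h w$ with $w$ close to the cell index of $(u, v)$
renormalise near $a$, up to $O(\eta)$. Every cell of the window can then be reached by an admissible translation.\<close>

lemma renorm_index_bound:
  fixes y i i' :: int
  assumes a: "\<bar>a\<bar> \<le> 4 + M" and i: "\<bar>\<lfloor>lam * y\<rfloor> - i\<bar> \<le> 2" "\<lfloor>(X u + r * Y v - a) / h\<rfloor> = i"
    and i': "0 \<le> i'" "i' < int H"
  shows "renorm_index a r y u v - i' \<in> {-J..J}"
proof -
  let ?D = "lam * y - (X u + r * Y v - a) / h"
  let ?E = "?D / lam - a / \<eta>"
  have "\<bar>?D\<bar> \<le> 3" using i by linarith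
  then have "\<bar>?D / lam\<bar> \<le> 3 / lam" using lam by (simp add: abs_divide divide_right_mono)
  then have "h * \<bar>?D / lam\<bar> \<le> h * (3 / lam)" using h by (intro mult_left_mono) auto
  also have "h * (3 / lam) = 3 * \<eta>" using lam by (simp add: h_def)
  finally have 1: "h * \<bar>?D / lam\<bar> \<le> 3 * \<eta>" .
  have "h * \<bar>a / \<eta>\<bar> = lam * \<bar>a\<bar>" using \<eta> by (simp add: h_def abs_divide)
  also have "\<dots> \<le> lam * (4 + M)" using a lam by (intro mult_left_mono) auto
  finally have 2: "h * \<bar>a / \<eta>\<bar> \<le> \<tau> / 8" using lam by linarith
  have ri: "renorm_index a r y u v = \<lfloor>?E\<rfloor>" by (simp add: renorm_index_def renorm_eq)
  have "\<bar>real_of_int (\<lfloor>?E\<rfloor> - i')\<bar> \<le> \<bar>?D / lam\<bar> + \<bar>a / \<eta>\<bar> + 1 + H" using i' by linarith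
  then have "h * \<bar>real_of_int (\<lfloor>?E\<rfloor> - i')\<bar> \<le> h * (\<bar>?D / lam\<bar> + \<bar>a / \<eta>\<bar> + 1 + H)"
    using h by (intro mult_left_mono) auto
  also have "\<dots> = h * \<bar>?D / lam\<bar> + h * \<bar>a / \<eta>\<bar> + h + H * h" by (simp add: algebra_simps)
  also have "\<dots> \<le> \<tau> - h" using 1 2 H(3) h(3) \<eta>(2) \<tau> by linarith
  finally have "h * \<bar>real_of_int (\<lfloor>?E\<rfloor> - i')\<bar> \<le> \<tau> - h" .
  then have "\<bar>real_of_int (\<lfloor>?E\<rfloor> - i')\<bar> \<le> \<tau> / h - 1" using h(1) by (simp add: field_simps)
  then have "\<bar>\<lfloor>?E\<rfloor> - i'\<bar> \<le> J" using J(3) by linarith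
  then show ?thesis unfolding ri by auto
qed

text \<open>If the number of grid points and grid parameters, bounded by $9(M+1)/\rho^2$, times the failure
probability is below $1$, then one choice of translations works for all parameters near a good
grid parameter $s\rho$.\<close>

lemma exists_translations:
  assumes few: "9 * (M + 1) / \<rho>\<^sup>2 * exp (- (p0 * (\<eta> * q / (4 * Cw) * \<sigma> ^ k))) < 1"
  shows "\<exists>t. (\<forall>u. \<bar>t u\<bar> \<le> \<tau> * lam) \<and>
     (\<forall>s::nat. \<forall>r. s * \<rho> \<le> M \<and> good (s * \<rho>) \<and> 1 / (2 * M) \<le> s * \<rho> \<and> s * \<rho> \<le> r \<and> r < (real s + 1) * \<rho> \<longrightarrow>
       (\<exists>\<Omega> b c C. b < c \<and> {b..c} \<subseteq> \<Omega> \<and> (\<forall>x\<in>\<Omega>. \<bar>x\<bar> \<le> C) \<and>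
          (\<forall>x\<in>\<Omega>. \<exists>u\<in>W. \<exists>v\<in>W. (x - (X u + t u) - r * Y v) / lam \<in> \<Omega>)))"
proof -
  define G where "G = {s::nat. s * \<rho> \<le> M \<and> good (s * \<rho>) \<and> 1 / (2 * M) \<le> s * \<rho>}"
  define D where "D = {-J..J}"
  define m where "m = \<eta> * q / (4 * Cw) * \<sigma> ^ k"
  define P where "P s a Q \<longleftrightarrow> \<bar>a\<bar> \<le> 4 + M \<and> Q \<subseteq> {0..<int H} \<and> p0 * card D \<le> card Q \<and>
      (\<forall>i\<in>Q. m \<le> card {u\<in>W. \<exists>v\<in>W. \<lfloor>(X u + (s * \<rho>) * Y v - a) / h\<rfloor> = i})" for s :: nat and a Q
  have "\<exists>a Q. s \<in> G \<longrightarrow> P s a Q" for s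
    using good_ratio[of "s * \<rho>"] unfolding G_def P_def D_def m_def by blast
  then obtain a Q where aQ: "\<And>s. s \<in> G \<Longrightarrow> P s (a s) (Q s)" by metis
  have aP: "\<bar>a s\<bar> \<le> 4 + M" "Q s \<subseteq> {0..<int H}" "p0 * card D \<le> card (Q s)" if "s \<in> G" for s
    using aQ[OF that] by (auto simp: P_def)
  have nP: "m \<le> card {u\<in>W. \<exists>v\<in>W. \<lfloor>(X u + (s * \<rho>) * Y v - a s) / h\<rfloor> = i}" if "s \<in> G" "i \<in> Q s" for s i
    using aQ[OF that(1)] that(2) by (auto simp: P_def)
  \<comment> \<open>the events: a good grid parameter together with a grid point close to a filled cell\<close>
  define I where "I = {(s, y::int). s \<in> G \<and> (\<exists>i\<in>Q s. \<bar>\<lfloor>lam * y\<rfloor> - i\<bar> \<le> 2)}"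
  define Z where "Z = \<lfloor>(H + 2) / lam\<rfloor>"
  have fG: "finite G" "card G \<le> (M + 1) / \<rho>"
  proof -
    have sub: "G \<subseteq> {s::nat. s * \<rho> \<le> M}" by (auto simp: G_def)
    note S = card_times_le[OF \<rho>(1), of M]
    show "finite G" using sub S(1) M finite_subset by auto
    have "card G \<le> card {s::nat. s * \<rho> \<le> M}" using sub S(1) M by (intro card_mono) auto
    then have "card G \<le> M / \<rho> + 1" using S(2) M by linarith
    also have "\<dots> \<le> (M + 1) / \<rho>"
    proof -
      have "1 \<le> 1 / \<rho>" using \<rho> h by simp
      then show ?thesis by (simp add: add_divide_distrib)
    qed
    finally show "card G \<le> (M + 1) / \<rho>" .
  qed
  have subI: "I \<subseteq> G \<times> {-Z..Z}"
  proof (rule subrelI)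
    fix s y assume "(s, y) \<in> I"
    then obtain i where s: "s \<in> G" and i: "i \<in> Q s" "\<bar>\<lfloor>lam * y\<rfloor> - i\<bar> \<le> 2" by (auto simp: I_def)
    have "0 \<le> i" "i < int H" using aP(2)[OF s] i(1) by auto
    then have "\<bar>lam * y\<bar> \<le> H + 2" using i(2) H(1) by linarith
    then have "\<bar>real_of_int y\<bar> \<le> (H + 2) / lam" using lam by (simp add: abs_mult field_simps)
    then have "\<bar>y\<bar> \<le> Z" unfolding Z_def by linarith
    then show "(s, y) \<in> G \<times> {-Z..Z}" using s by auto
  qed
  have fI: "finite I" using subI fG finite_subset by blast
  have cI: "card I \<le> 9 * (M + 1) / \<rho>\<^sup>2"
  proof -
    have Z0: "0 \<le> Z" using lam by (simp add: Z_def)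
    have "real (card {-Z..Z}) = 2 * Z + 1" using Z0 by simp
    also have "\<dots> \<le> 2 * ((H + 2) / lam) + 1 / lam"
    proof -
      have "Z \<le> (H + 2) / lam" unfolding Z_def by linarith
      moreover have "1 \<le> 1 / lam" using lam by simp
      ultimately show ?thesis by linarith
    qed
    also have "\<dots> = (2 * H + 5) / lam" using lam(1) by (simp add: divide_simps)
    also have "\<dots> \<le> (9 / h) / lam"
    proof -
      have "2 * H \<le> 4 / h" using H(4) by simp
      moreover have "5 \<le> 5 / h" using h by (simp add: field_simps)
      ultimately have "2 * H + 5 \<le> 4 / h + 5 / h" by linarith
      then have "2 * H + 5 \<le> 9 / h" by (simp add: add_divide_distrib[symmetric])
      then show ?thesis using lam by (intro divide_right_mono) auto
    qed
    also have "\<dots> = 9 / \<rho>" by (simp add: \<rho>_def mult.commute)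
    finally have cZ: "card {-Z..Z} \<le> 9 / \<rho>" .
    have "card I \<le> card (G \<times> {-Z..Z})" using subI fG by (intro card_mono) auto
    then have "real (card I) \<le> real (card G) * real (card {-Z..Z})"
      unfolding card_cartesian_product of_nat_mult[symmetric] of_nat_le_iff .
    also have "\<dots> \<le> ((M + 1) / \<rho>) * (9 / \<rho>)"
      using fG(2) cZ M \<rho> by (intro mult_mono) auto
    finally show ?thesis by (simp add: power2_eq_square mult_ac)
  qed
  have "\<exists>i. e \<in> I \<longrightarrow> i \<in> Q (fst e) \<and> \<bar>\<lfloor>lam * real_of_int (snd e)\<rfloor> - i\<bar> \<le> 2" for e
    by (cases e) (auto simp: I_def)
  then obtain \<iota> where \<iota>: "\<And>e. e \<in> I \<Longrightarrow> \<iota> e \<in> Q (fst e) \<and> \<bar>\<lfloor>lam * real_of_int (snd e)\<rfloor> - \<iota> e\<bar> \<le> 2" by metis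
  define S where "S e = {u\<in>W. \<exists>v\<in>W. \<lfloor>(X u + (real (fst e) * \<rho>) * Y v - a (fst e)) / h\<rfloor> = \<iota> e}" for e
  define A where "A e u = {j\<in>D. \<exists>v\<in>W. renorm_index (a (fst e)) (real (fst e) * \<rho>) (real_of_int (snd e)) u v - j \<in> Q (fst e)}" for e u
  have "\<exists>t\<in>W \<rightarrow> D. \<forall>e\<in>I. \<exists>u\<in>S e. t u \<in> A e u"
  proof (rule exists_choice_meeting_all[where p = p0 and m = m])
    show "finite W" "finite D" "D \<noteq> {}" "finite I" using J(1) fI by (auto simp: D_def)
    show "S e \<subseteq> W" for e by (auto simp: S_def)
    show "m \<le> card (S e)" if "e \<in> I" for e
      unfolding S_def using that \<iota>[OF that] by (intro nP) (auto simp: I_def)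
    show "A e u \<subseteq> D \<and> p0 * card D \<le> card (A e u)" if e: "e \<in> I" and u: "u \<in> S e" for e u
    proof
      show "A e u \<subseteq> D" by (auto simp: A_def)
      have s: "fst e \<in> G" using e by (auto simp: I_def)
      obtain v where v: "v \<in> W" "\<lfloor>(X u + (real (fst e) * \<rho>) * Y v - a (fst e)) / h\<rfloor> = \<iota> e"
        using u by (auto simp: S_def)
      let ?g = "\<lambda>i. renorm_index (a (fst e)) (real (fst e) * \<rho>) (real_of_int (snd e)) u v - i"
      have "?g i \<in> D" if "i \<in> Q (fst e)" for i
        unfolding D_def
        by (rule renorm_index_bound[OF aP(1)[OF s] _ v(2)]) (use \<iota>[OF e] aP(2)[OF s] that in auto)
      moreover have "renorm_index (a (fst e)) (real (fst e) * \<rho>) (real_of_int (snd e)) u v - ?g i = i" for i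
        by simp
      ultimately have "?g i \<in> A e u" if "i \<in> Q (fst e)" for i
        unfolding A_def using v(1) that by (metis (mono_tags, lifting) mem_Collect_eq)
      then have sub: "?g ` Q (fst e) \<subseteq> A e u" by blast
      have "p0 * card D \<le> card (Q (fst e))" by (rule aP(3)[OF s])
      also have "card (Q (fst e)) = card (?g ` Q (fst e))" by (rule card_image[symmetric]) (auto simp: inj_on_def)
      also have "real \<dots> \<le> card (A e u)"
      proof -
        have "finite (A e u)" by (rule finite_subset[of _ D]) (auto simp: A_def D_def)
        then show ?thesis using card_mono[OF _ sub] by simp
      qed
      finally show "p0 * card D \<le> card (A e u)" .
    qed
    show "0 \<le> p0" using consts_pos by simp
    have "card I * exp (- (p0 * m)) \<le> 9 * (M + 1) / \<rho>\<^sup>2 * exp (- (p0 * m))"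
      using cI by (intro mult_right_mono) auto
    then show "card I * exp (- (p0 * m)) < 1" using few by (simp add: m_def)
  qed
  then obtain j where j: "\<And>u. u \<in> W \<Longrightarrow> j u \<in> D" and hit: "\<And>e. e \<in> I \<Longrightarrow> \<exists>u\<in>S e. j u \<in> A e u" by blast
  define t where "t u = (if u \<in> W then lam * h * j u else 0)" for u
  have tb: "\<bar>t u\<bar> \<le> \<tau> * lam" for u
  proof (cases "u \<in> W")
    case True
    have "\<bar>real_of_int (j u)\<bar> \<le> J" using j[OF True] by (auto simp: D_def)
    then have "h * \<bar>real_of_int (j u)\<bar> \<le> h * J" using h by (intro mult_left_mono) auto
    then have "h * \<bar>real_of_int (j u)\<bar> \<le> \<tau>" using J(2) by (simp add: mult.commute)
    then have "lam * (h * \<bar>real_of_int (j u)\<bar>) \<le> lam * \<tau>" using lam by (intro mult_left_mono) auto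
    then show ?thesis using True lam h by (simp add: t_def abs_mult mult_ac)
  qed (use \<tau> lam in \<open>auto simp: t_def\<close>)
  have main: "\<exists>\<Omega> b c C. b < c \<and> {b..c} \<subseteq> \<Omega> \<and> (\<forall>x\<in>\<Omega>. \<bar>x\<bar> \<le> C) \<and>
          (\<forall>x\<in>\<Omega>. \<exists>u\<in>W. \<exists>v\<in>W. (x - (X u + t u) - r * Y v) / lam \<in> \<Omega>)"
    if s: "s \<in> G" and r: "s * \<rho> \<le> r" "r < (real s + 1) * \<rho>" for s :: nat and r
  proof -
    define \<kappa> where "\<kappa> = a s + lam * a s"
    \<comment> \<open>the margins $-1$ and $2$ absorb the replacement of $x$ by a grid point and of $r$ by $s\rho$\<close>
    define \<Omega> where "\<Omega> = {x. \<exists>i\<in>Q s. -1 \<le> \<lfloor>(x - \<kappa>) / h\<rfloor> - i \<and> \<lfloor>(x - \<kappa>) / h\<rfloor> - i \<le> 2}"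
    have "0 < p0 * card D" using consts_pos J(1) by (simp add: D_def)
    then have "0 < card (Q s)" using aP(3)[OF s] by linarith
    then obtain i where i: "i \<in> Q s" by (auto simp: card_gt_0_iff)
    define b where "b = \<kappa> + h * i"
    have "{b..b + h / 2} \<subseteq> \<Omega>"
    proof
      fix x assume "x \<in> {b..b + h / 2}"
      then have "i \<le> (x - \<kappa>) / h" "(x - \<kappa>) / h < i + 1" using h(1) by (auto simp: b_def field_simps)
      then have "\<lfloor>(x - \<kappa>) / h\<rfloor> = i" by linarith
      then show "x \<in> \<Omega>" using i unfolding \<Omega>_def by (intro CollectI bexI[of _ i]) auto
    qed
    moreover have "b < b + h / 2" using h by simp
    moreover have "\<forall>x\<in>\<Omega>. \<bar>x\<bar> \<le> \<bar>\<kappa>\<bar> + h * (H + 3)"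
    proof
      fix x assume "x \<in> \<Omega>"
      then obtain i where i: "i \<in> Q s" "-1 \<le> \<lfloor>(x - \<kappa>) / h\<rfloor> - i" "\<lfloor>(x - \<kappa>) / h\<rfloor> - i \<le> 2" by (auto simp: \<Omega>_def)
      have "0 \<le> i" "i < int H" using aP(2)[OF s] i(1) by auto
      then have "\<bar>(x - \<kappa>) / h\<bar> \<le> H + 3" using i(2,3) by linarith
      then have "\<bar>x - \<kappa>\<bar> \<le> h * (H + 3)" using h(1) by (simp add: abs_divide field_simps)
      then show "\<bar>x\<bar> \<le> \<bar>\<kappa>\<bar> + h * (H + 3)" by linarith
    qed
    moreover have "\<forall>x\<in>\<Omega>. \<exists>u\<in>W. \<exists>v\<in>W. (x - (X u + t u) - r * Y v) / lam \<in> \<Omega>"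
    proof
      fix x assume "x \<in> \<Omega>"
      then obtain i where i: "i \<in> Q s" "-1 \<le> \<lfloor>(x - \<kappa>) / h\<rfloor> - i" "\<lfloor>(x - \<kappa>) / h\<rfloor> - i \<le> 2" by (auto simp: \<Omega>_def)
      define w where "w = (x - \<kappa>) / h"
      \<comment> \<open>the grid point of mesh $\lambda h$ to the left of $x$\<close>
      define y where "y = \<lfloor>w / lam\<rfloor>"
      have \<delta>1: "0 \<le> w / lam - y" "w / lam - y < 1" unfolding y_def by linarith+
      have "0 \<le> w - lam * y" "w - lam * y < lam"
        using \<delta>1 lam(1) by (auto simp: field_simps)
      then have "\<bar>\<lfloor>lam * y\<rfloor> - i\<bar> \<le> 2" using i(2,3) lam(2) unfolding w_def[symmetric] by linarith
      then have "(s, y) \<in> I" using s i(1) by (auto simp: I_def)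
      from hit[OF this] obtain u v where u: "u \<in> W" and v: "v \<in> W"
        and in_Q: "renorm_index (a s) (s * \<rho>) y u v - j u \<in> Q s"
        by (auto simp: A_def S_def)
      define E where "E = ((a s + lam * a s + lam * h * y - X u - (s * \<rho>) * Y v) / lam - a s - lam * a s) / h"
      have E: "renorm_index (a s) (s * \<rho>) y u v = \<lfloor>E\<rfloor>" by (simp add: renorm_index_def E_def)
      define \<delta> where "\<delta> = (r - s * \<rho>) / \<rho> * Y v"
      have \<delta>: "\<bar>\<delta>\<bar> \<le> 1"
      proof -
        have "0 \<le> (r - s * \<rho>) / \<rho>" "(r - s * \<rho>) / \<rho> \<le> 1" using r \<rho> by (auto simp: field_simps)
        then show ?thesis unfolding \<delta>_def abs_mult using XY_le(2)[OF v] by (intro mult_le_one) auto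
      qed
      define x' where "x' = (x - (X u + t u) - r * Y v) / lam"
      have x: "x = \<kappa> + h * w" using h(1) by (simp add: w_def)
      have "(x' - \<kappa>) / h = E + (w / lam - y) - \<delta> - j u"
        using lam(1) h(1) u unfolding x'_def E_def x \<delta>_def \<rho>_def t_def \<kappa>_def
        by (simp add: field_simps)
      then have "-1 \<le> \<lfloor>(x' - \<kappa>) / h\<rfloor> - (\<lfloor>E\<rfloor> - j u)" "\<lfloor>(x' - \<kappa>) / h\<rfloor> - (\<lfloor>E\<rfloor> - j u) \<le> 2"
        using \<delta>1 \<delta> by linarith+
      then have "x' \<in> \<Omega>" using in_Q unfolding \<Omega>_def E by blast
      then show "\<exists>u\<in>W. \<exists>v\<in>W. (x - (X u + t u) - r * Y v) / lam \<in> \<Omega>"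
        using u v unfolding x'_def by blast
    qed
    ultimately show ?thesis by blast
  qed
  show ?thesis
  proof (intro exI[of _ t] conjI allI impI, goal_cases)
    case (1 u)
    show ?case by (rule tb)
  next
    case (2 s r)
    then show ?case by (intro main[of s r]) (auto simp: G_def)
  qed
qed

end

lemma power_times_exp_neg_power_tendsto_0:
  fixes b c \<sigma> :: real
  assumes "0 \<le> b" "0 < c" "1 < \<sigma>"
  shows "(\<lambda>k. b ^ k * exp (- (c * \<sigma> ^ k))) \<longlonglongrightarrow> 0"
proof -
  obtain n where n: "b < \<sigma> ^ n" using real_arch_pow[OF assms(3)] by blast
  define m where "m = Suc n"
  have "\<sigma> ^ n \<le> \<sigma> ^ m" using assms(3) unfolding m_def by (intro power_increasing) auto
  then have m: "b < \<sigma> ^ m" using n by simp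
  have le: "b ^ k * exp (- (c * \<sigma> ^ k)) \<le> (m / c) ^ m * (b / \<sigma> ^ m) ^ k" for k
  proof -
    have x: "0 < c * \<sigma> ^ k" using assms by simp
    have "(c * \<sigma> ^ k / m) ^ m \<le> (1 + c * \<sigma> ^ k / m) ^ m" using x by (intro power_mono) auto
    also have "\<dots> \<le> exp (c * \<sigma> ^ k)"
      by (rule exp_ge_one_plus_x_over_n_power_n) (use x in \<open>auto simp: m_def\<close>)
    finally have "exp (- (c * \<sigma> ^ k)) \<le> inverse ((c * \<sigma> ^ k / m) ^ m)"
      unfolding exp_minus using x by (intro le_imp_inverse_le) (auto simp: m_def)
    also have "\<dots> = (m / c) ^ m * (1 / \<sigma> ^ m) ^ k"
      by (simp add: power_divide power_mult_distrib field_simps power_mult[symmetric])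
    finally have "b ^ k * exp (- (c * \<sigma> ^ k)) \<le> b ^ k * ((m / c) ^ m * (1 / \<sigma> ^ m) ^ k)"
      using assms by (intro mult_left_mono) auto
    then show ?thesis by (simp add: power_divide mult_ac)
  qed
  have lim: "(\<lambda>k. (m / c) ^ m * (b / \<sigma> ^ m) ^ k) \<longlonglongrightarrow> (m / c) ^ m * 0"
    using assms m by (intro tendsto_mult tendsto_const LIMSEQ_realpow_zero) (auto simp: divide_less_eq)
  show ?thesis
  proof (rule tendsto_sandwich[where f = "\<lambda>_. 0" and h = "\<lambda>k. (m / c) ^ m * (b / \<sigma> ^ m) ^ k"])
    show "\<forall>\<^sub>F k in sequentially. 0 \<le> b ^ k * exp (- (c * \<sigma> ^ k))"
      using assms by (intro always_eventually) simp
    show "\<forall>\<^sub>F k in sequentially. b ^ k * exp (- (c * \<sigma> ^ k)) \<le> (m / c) ^ m * (b / \<sigma> ^ m) ^ k"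
      using le by (intro always_eventually) simp
    show "(\<lambda>k. (m / c) ^ m * (b / \<sigma> ^ m) ^ k) \<longlonglongrightarrow> 0" using lim by simp
  qed simp
qed

text \<open>The perturbation theorem for homogeneous systems. The level $k$ is chosen so large that
$\exp(-\mathrm{const}\cdot\sigma^k)$ outweighs the number of events, which is a constant times $q^{-4k}$. The set $E$ consists of
the grid intervals $[s\rho, (s+1)\rho)$ with $s\rho$ good, cut down to $(1/M, M)$.\<close>

theorem (in homogeneous_ifs) exists_good_translations:
  assumes \<sigma>: "1 < \<sigma>" and letters: "\<alpha> \<in> B" "\<omega> \<in> B"
    and M: "1 \<le> M" and \<tau>: "0 < \<tau>" "\<tau> \<le> 1" and \<epsilon>: "0 < \<epsilon>"
  shows "\<exists>k t E. (\<forall>u. \<bar>t u\<bar> \<le> \<tau> * q ^ Suc k) \<and> E \<in> sets lebesgue \<and> E \<subseteq> {1 / M<..<M} \<and>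
     measure lebesgue ({1 / M<..<M} - E) < \<epsilon> \<and>
     (\<forall>r\<in>E. \<exists>\<Omega> b c C. b < c \<and> {b..c} \<subseteq> \<Omega> \<and> (\<forall>x\<in>\<Omega>. \<bar>x\<bar> \<le> C) \<and>
        (\<forall>x\<in>\<Omega>. \<exists>u\<in>words B k. \<exists>v\<in>words B k.
           (x - (off (\<alpha> # u) + t u) - r * off (\<omega> # v)) / q ^ Suc k \<in> \<Omega>))"
proof -
  define \<eta> where "\<eta> = min (\<tau> / 16) (min (\<gamma> / (2 * M)) (1 / (2 * M)))"
  have \<eta>: "0 < \<eta>" "\<eta> \<le> \<tau> / 16" "\<eta> \<le> \<gamma> / (2 * M)" "\<eta> \<le> 1 / (2 * M)"
    using \<tau> \<gamma> M by (auto simp: \<eta>_def)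
  define Cw where "Cw = 8 * (1 + M) / \<tau> + 2"
  define CE where "CE = 2 * C0 M / (q * \<epsilon>)"
  define c where "c = \<eta> / (12 * Cw\<^sup>2 * CE) * (\<eta> * q / (4 * Cw))"
  have "0 < Cw" unfolding Cw_def using M \<tau> by (intro add_pos_pos divide_pos_pos) auto
  moreover have "0 < C0 M"
    unfolding C0_def using M \<gamma> \<sigma> by (intro mult_pos_pos add_pos_pos divide_pos_pos) auto
  ultimately have c0: "0 < c" unfolding c_def CE_def using \<eta> q \<epsilon> by simp
  have "(\<lambda>k. 9 * (M + 1) / (\<eta>\<^sup>2 * q ^ 4) * ((1 / q ^ 4) ^ k * exp (- (c * \<sigma> ^ k))))
      \<longlonglongrightarrow> 9 * (M + 1) / (\<eta>\<^sup>2 * q ^ 4) * 0"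
    using q c0 \<sigma> by (intro tendsto_mult tendsto_const power_times_exp_neg_power_tendsto_0) auto
  then have ev1: "\<forall>\<^sub>F k in sequentially.
      9 * (M + 1) / (\<eta>\<^sup>2 * q ^ 4) * ((1 / q ^ 4) ^ k * exp (- (c * \<sigma> ^ k))) < 1"
    by (rule order_tendstoD(2)) simp
  have "(\<lambda>k. q ^ Suc k * (4 + M)) \<longlonglongrightarrow> 0 * (4 + M)"
    using q by (intro tendsto_mult tendsto_const LIMSEQ_Suc LIMSEQ_realpow_zero) auto
  then have ev2: "\<forall>\<^sub>F k in sequentially. q ^ Suc k * (4 + M) < \<tau> / 8"
    by (rule order_tendstoD(2)) (use \<tau> in simp)
  obtain k where k1: "9 * (M + 1) / (\<eta>\<^sup>2 * q ^ 4) * ((1 / q ^ 4) ^ k * exp (- (c * \<sigma> ^ k))) < 1"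
    and k2: "q ^ Suc k * (4 + M) < \<tau> / 8"
    using eventually_conj[OF ev1 ev2] by (auto simp: eventually_sequentially)
  interpret P: perturbed_sum B \<beta> q lo hi \<gamma> \<alpha> \<omega> M \<tau> \<epsilon> \<eta> k
    by unfold_locales (use letters M \<tau> \<epsilon> \<sigma> \<eta> k2 in auto)
  have pc: "P.p0 * (\<eta> * q / (4 * P.Cw) * \<sigma> ^ k) = c * \<sigma> ^ k"
    by (simp add: P.p0_def P.Cw_def P.CE_def c_def Cw_def CE_def)
  have "P.\<rho>\<^sup>2 = \<eta>\<^sup>2 * q ^ 4 * (q ^ 4) ^ k"
    by (simp add: P.\<rho>_def P.h_def P.lam_def power2_eq_square power4_eq_xxxx power_mult_distrib)
  then have "9 * (M + 1) / P.\<rho>\<^sup>2 * exp (- (c * \<sigma> ^ k))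
      = 9 * (M + 1) / (\<eta>\<^sup>2 * q ^ 4) * ((1 / q ^ 4) ^ k * exp (- (c * \<sigma> ^ k)))"
    by (simp add: power_divide)
  then have few: "9 * (M + 1) / P.\<rho>\<^sup>2 * exp (- (P.p0 * (\<eta> * q / (4 * P.Cw) * \<sigma> ^ k))) < 1"
    unfolding pc using k1 by simp
  obtain t where t: "\<forall>u. \<bar>t u\<bar> \<le> \<tau> * P.lam"
    and tr: "\<forall>s::nat. \<forall>r. s * P.\<rho> \<le> M \<and> P.good (s * P.\<rho>) \<and> 1 / (2 * M) \<le> s * P.\<rho> \<and>
        s * P.\<rho> \<le> r \<and> r < (real s + 1) * P.\<rho> \<longrightarrow>
       (\<exists>\<Omega> b c C. b < c \<and> {b..c} \<subseteq> \<Omega> \<and> (\<forall>x\<in>\<Omega>. \<bar>x\<bar> \<le> C) \<and>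
          (\<forall>x\<in>\<Omega>. \<exists>u\<in>P.W. \<exists>v\<in>P.W. (x - (P.X u + t u) - r * P.Y v) / P.lam \<in> \<Omega>))"
    by (rule exE[OF P.exists_translations[OF few]], elim conjE) (rule that)
  let ?I = "\<lambda>s::nat. {real s * P.\<rho>..<(real s + 1) * P.\<rho>}"
  define E where "E = {1 / M<..<M} \<inter> (\<Union>s\<in>{s. P.good (real s * P.\<rho>)}. ?I s)"
  define bad where "bad = {s::nat. s * P.\<rho> \<le> M \<and> \<not> P.good (s * P.\<rho>)}"
  have \<rho>: "P.\<rho> \<le> 1 / (2 * M)" using P.\<rho>(2) P.h(3) \<eta>(4) by linarith
  have fb: "finite bad"
    by (rule finite_subset[OF _ card_times_le(1)[OF P.\<rho>(1), of M]]) (use M in \<open>auto simp: bad_def\<close>)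
  have Em: "E \<in> sets lebesgue" unfolding E_def
    by (intro sets.Int sets.countable_UN'') (auto intro: sets_completionI_sets)
  have diff: "{1 / M<..<M} - E \<subseteq> (\<Union>s\<in>bad. ?I s)"
  proof
    fix r assume r: "r \<in> {1 / M<..<M} - E"
    have "0 < 1 / M" using M by simp
    then have r0: "0 < r" using r by (meson DiffD1 greaterThanLessThan_iff less_trans)
    define s where "s = nat \<lfloor>r / P.\<rho>\<rfloor>"
    have "real s = \<lfloor>r / P.\<rho>\<rfloor>" using r0 P.\<rho>(1) by (simp add: s_def)
    then have "real s \<le> r / P.\<rho>" "r / P.\<rho> < real s + 1" by linarith+
    then have s: "r \<in> ?I s" using P.\<rho>(1) by (simp add: field_simps)
    then have "\<not> P.good (real s * P.\<rho>)" using r by (auto simp: E_def)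
    moreover have "real s * P.\<rho> \<le> M" using s r by auto
    ultimately show "r \<in> (\<Union>s\<in>bad. ?I s)" using s by (auto simp: bad_def)
  qed
  have Im: "?I s \<in> lmeasurable" for s by (intro bounded_set_imp_lmeasurable) auto
  have "measure lebesgue ({1 / M<..<M} - E) \<le> measure lebesgue (\<Union>s\<in>bad. ?I s)"
  proof (rule measure_mono_fmeasurable[OF diff])
    show "{1 / M<..<M} - E \<in> sets lebesgue" using Em by (intro sets.Diff) auto
    show "(\<Union>s\<in>bad. ?I s) \<in> lmeasurable" using fb Im by (intro fmeasurable.finite_UN) auto
  qed
  also have "\<dots> \<le> (\<Sum>s\<in>bad. measure lebesgue (?I s))"
    using fb by (intro measure_UNION_le) auto
  also have "\<dots> = (\<Sum>s\<in>bad. P.\<rho>)" using P.\<rho>(1) by (intro sum.cong refl) (simp add: algebra_simps)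
  also have "\<dots> = card bad * P.\<rho>" by simp
  also have "\<dots> \<le> \<epsilon> / 2" unfolding bad_def by (rule P.card_bad_le)
  also have "\<dots> < \<epsilon>" using \<epsilon> by simp
  finally have meas: "measure lebesgue ({1 / M<..<M} - E) < \<epsilon>" .
  have main: "\<exists>\<Omega> b c C. b < c \<and> {b..c} \<subseteq> \<Omega> \<and> (\<forall>x\<in>\<Omega>. \<bar>x\<bar> \<le> C) \<and>
        (\<forall>x\<in>\<Omega>. \<exists>u\<in>words B k. \<exists>v\<in>words B k.
           (x - (off (\<alpha> # u) + t u) - r * off (\<omega> # v)) / q ^ Suc k \<in> \<Omega>)" if r: "r \<in> E" for r
  proof -
    obtain s where s: "P.good (real s * P.\<rho>)" "real s * P.\<rho> \<le> r" "r < (real s + 1) * P.\<rho>"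
      and rM: "1 / M < r" "r < M" using r by (auto simp: E_def)
    have "r < real s * P.\<rho> + P.\<rho>" using s(3) by (simp add: algebra_simps)
    moreover have "1 / M = 1 / (2 * M) + 1 / (2 * M)" using M by simp
    ultimately have "1 / (2 * M) \<le> real s * P.\<rho>" using rM \<rho> by linarith
    moreover have "real s * P.\<rho> \<le> M" using s rM by linarith
    ultimately show ?thesis
      using tr[rule_format, of s r] s unfolding P.W_def P.X_def P.Y_def P.lam_def by simp
  qed
  show ?thesis
  proof (rule exI[of _ k], rule exI[of _ t], rule exI[of _ E], intro conjI ballI)
    show "\<forall>u. \<bar>t u\<bar> \<le> \<tau> * q ^ Suc k" using t unfolding P.lam_def .
    show "E \<subseteq> {1 / M<..<M}" by (auto simp: E_def)
  qed (fact Em meas main)+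
qed

section \<open>Dimension and homogeneous subsystems\<close>

text \<open>Exponential growth beats polynomial growth, by $(1 + x/m)^m \le e^x$ for $m = p + 1$ and $x = n \ln S$.\<close>

lemma exists_nat_power_gt_polynomial:
  fixes S :: real
  assumes "1 < S"
  shows "\<exists>n>0. real (Suc n) ^ p < S ^ n"
proof -
  define a where "a = ln S / Suc p"
  have a: "0 < a" using assms by (simp add: a_def)
  obtain n :: nat where n: "2 ^ p / a ^ Suc p < n" using reals_Archimedean2 by blast
  have "0 < 2 ^ p / a ^ Suc p" using a by simp
  then have n0: "0 < n" using n by (metis less_trans of_nat_0_less_iff)
  have "real (Suc n) ^ p \<le> (2 * real n) ^ p" using n0 by (intro power_mono) auto
  also have "\<dots> = 2 ^ p * real n ^ p" by (simp add: power_mult_distrib)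
  also have "\<dots> < (n * a ^ Suc p) * real n ^ p"
    using n n0 a by (intro mult_strict_right_mono) (auto simp: divide_less_eq)
  also have "\<dots> = (n * a) ^ Suc p" by (simp add: power_mult_distrib)
  also have "\<dots> \<le> (1 + n * a) ^ Suc p" using a by (intro power_mono) auto
  also have "\<dots> = (1 + (n * ln S) / Suc p) ^ Suc p" by (simp add: a_def)
  also have "\<dots> \<le> exp (n * ln S)"
  proof (rule exp_ge_one_plus_x_over_n_power_n)
    have "0 \<le> n * ln S" using assms by simp
    then show "- real (Suc p) \<le> n * ln S" by linarith
  qed simp
  also have "\<dots> = S ^ n" using assms by (simp add: exp_of_nat_mult)
  finally show ?thesis using n0 by blast
qed

context affine_ifs
begin

lemma sum_words_powr:
  "(\<Sum>w\<in>words A n. \<bar>wr w\<bar> powr s) = (\<Sum>a\<in>A. \<bar>c a\<bar> powr s) ^ n"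
proof (induction n)
  case (Suc n)
  then show ?case
    by (simp add: sum_words_Suc finite_A abs_mult powr_mult sum_distrib_right sum_distrib_left[symmetric])
qed simp

lemma hausdorff_measure_eq_0:
  assumes s: "0 < s" and lt: "(\<Sum>a\<in>A. \<bar>c a\<bar> powr s) < 1"
  shows "hausdorff_measure s K = 0"
proof -
  define S where "S = (\<Sum>a\<in>A. \<bar>c a\<bar> powr s)"
  have S: "0 \<le> S" "S < 1" using lt by (auto simp: S_def sum_nonneg)
  define \<theta> where "\<theta> = Max ((\<lambda>a. \<bar>c a\<bar>) ` A)"
  have \<theta>: "\<And>a. a \<in> A \<Longrightarrow> \<bar>c a\<bar> \<le> \<theta>" "0 \<le> \<theta>" "\<theta> < 1"
  proof -
    show "\<bar>c a\<bar> \<le> \<theta>" if "a \<in> A" for a unfolding \<theta>_def using finite_A that by (intro Max_ge) auto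
    then show "0 \<le> \<theta>" using A_ne by fastforce
    show "\<theta> < 1" unfolding \<theta>_def using finite_A A_ne ratio by (subst Max_less_iff) auto
  qed
  have wr\<theta>: "w \<in> words A n \<Longrightarrow> \<bar>wr w\<bar> \<le> \<theta> ^ n" for w n
  proof (induction n arbitrary: w)
    case (Suc n)
    then obtain a u where "w = a # u" "a \<in> A" "u \<in> words A n" by (auto simp: words_Suc)
    then show ?case using Suc.IH[of u] \<theta> by (auto simp: abs_mult intro: mult_mono)
  qed simp
  have pre: "hausdorff_premeasure s \<delta> K \<le> ennreal (S ^ n)" if n: "\<theta> ^ n \<le> \<delta>" for \<delta> n
  proof -
    have fW: "finite (words A n)" using finite_A by simp
    obtain e where e: "bij_betw e {0..<card (words A n)} (words A n)"
      using ex_bij_betw_nat_finite[OF fW] by blast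
    define F where "F w = (\<lambda>x. wr w * x + wo w) ` K" for w
    define U where "U i = (if i < card (words A n) then F (e i) else {})" for i
    have eW: "e i \<in> words A n" if "i < card (words A n)" for i
      using e that by (auto simp: bij_betw_def)
    have diam: "diameter (F w) \<le> \<bar>wr w\<bar>" for w
    proof (rule diameter_le)
      fix x y assume "x \<in> F w" "y \<in> F w"
      then obtain x' y' where xy: "x' \<in> K" "y' \<in> K" "x = wr w * x' + wo w" "y = wr w * y' + wo w"
        by (auto simp: F_def)
      have "x' \<in> {lo..hi}" "y' \<in> {lo..hi}" using K_sub xy(1,2) by blast+
      then have "\<bar>x' - y'\<bar> \<le> 1" using unit by (auto simp: abs_le_iff)
      then have "\<bar>wr w\<bar> * \<bar>x' - y'\<bar> \<le> \<bar>wr w\<bar> * 1" by (intro mult_left_mono) auto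
      then show "norm (x - y) \<le> \<bar>wr w\<bar>" by (simp add: xy abs_mult[symmetric] right_diff_distrib)
    qed simp
    have Kb: "bounded K" by (rule bounded_subset[OF compact_imp_bounded[OF compact_Icc] K_sub])
    have bF: "bounded (F w)" for w
    proof -
      have "F w \<subseteq> (+) (wo w) ` ((\<lambda>x. wr w *\<^sub>R x) ` K)" by (auto simp: F_def add.commute)
      then show ?thesis by (rule bounded_subset[OF bounded_translation[OF bounded_scaling[OF Kb]]])
    qed
    have cover: "K \<subseteq> (\<Union>i. U i)"
    proof
      fix x assume "x \<in> K"
      then have "x \<in> (\<Union>w\<in>words A n. F w)" unfolding F_def K_words[of n, symmetric] .
      then obtain w where w: "w \<in> words A n" "x \<in> F w" by blast
      have "w \<in> e ` {0..<card (words A n)}" using e w(1) by (simp add: bij_betw_def)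
      then obtain i where "i < card (words A n)" "w = e i" by auto
      then show "x \<in> (\<Union>i. U i)" using w by (auto simp: U_def)
    qed
    have small: "bounded (U i) \<and> diameter (U i) \<le> \<delta>" for i
    proof (cases "i < card (words A n)")
      case True
      have "diameter (F (e i)) \<le> \<theta> ^ n" using diam[of "e i"] wr\<theta>[OF eW[OF True]] by linarith
      then show ?thesis using True bF n by (simp add: U_def)
    next
      case False
      have "0 \<le> \<delta>" using n \<theta>(2) by (meson order_trans zero_le_power)
      then show ?thesis using False by (simp add: U_def)
    qed
    have "hausdorff_premeasure s \<delta> K \<le> (\<Sum>i. hausdorff_gauge s (U i))"
      unfolding hausdorff_premeasure_def using cover small by (intro INF_lower) auto
    also have "\<dots> = (\<Sum>i\<in>{0..<card (words A n)}. hausdorff_gauge s (U i))"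
      by (rule suminf_finite) (auto simp: U_def hausdorff_gauge_def)
    also have "\<dots> = (\<Sum>i\<in>{0..<card (words A n)}. ennreal (diameter (F (e i)) powr s))"
      using K_ne s by (intro sum.cong refl) (auto simp: U_def hausdorff_gauge_def F_def)
    also have "\<dots> = (\<Sum>w\<in>words A n. ennreal (diameter (F w) powr s))"
      by (rule sum.reindex_bij_betw[OF e])
    also have "\<dots> \<le> (\<Sum>w\<in>words A n. ennreal (\<bar>wr w\<bar> powr s))"
      using diam s by (intro sum_mono ennreal_leI powr_mono2 diameter_ge_0 bF) auto
    also have "\<dots> = ennreal (S ^ n)" by (simp add: sum_words_powr S_def)
    finally show ?thesis .
  qed
  have "hausdorff_premeasure s \<delta> K = 0" if "0 < \<delta>" for \<delta>
  proof -
    obtain n0 where n0: "\<theta> ^ n0 < \<delta>" using real_arch_pow_inv[OF \<open>0 < \<delta>\<close> \<theta>(3)] by blast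
    have "(\<lambda>n. ennreal (S ^ n)) \<longlonglongrightarrow> ennreal 0"
      using S by (intro tendsto_ennrealI LIMSEQ_realpow_zero) auto
    moreover
    have "\<forall>n\<ge>n0. hausdorff_premeasure s \<delta> K \<le> ennreal (S ^ n)"
    proof (intro allI impI pre)
      fix n assume "n0 \<le> n"
      then have "\<theta> ^ n \<le> \<theta> ^ n0" using \<theta> by (intro power_decreasing) auto
      then show "\<theta> ^ n \<le> \<delta>" using n0 by linarith
    qed
    ultimately have "hausdorff_premeasure s \<delta> K \<le> ennreal 0" by (intro LIMSEQ_le_const) auto
    then show ?thesis by simp
  qed
  then show ?thesis unfolding hausdorff_measure_def by (intro antisym SUP_least) auto
qed

lemma sum_sqrt_ratio_gt_1:
  assumes dim: "1 / 2 < hausdorff_dim K"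
  shows "1 < (\<Sum>a\<in>A. \<bar>c a\<bar> powr (1 / 2))"
proof (rule ccontr)
  assume "\<not> ?thesis"
  then have le1: "(\<Sum>a\<in>A. \<bar>c a\<bar> powr (1 / 2)) \<le> 1" by simp
  obtain y where y: "1 / 2 < y" "y < hausdorff_dim K" using dense[OF dim] by blast
  obtain s where s: "y = ennreal s" "0 \<le> s" using y(2) by (cases y) auto
  have "(1::ennreal) / 2 = ennreal 1 / ennreal 2" by simp
  also have "\<dots> = ennreal (1 / 2)" by (rule divide_ennreal) auto
  finally have "ennreal (1 / 2) < ennreal s" using y(1) unfolding s(1) by simp
  then have "1 / 2 < s" by (subst (asm) ennreal_less_iff) auto
  have "(\<Sum>a\<in>A. \<bar>c a\<bar> powr s) < (\<Sum>a\<in>A. \<bar>c a\<bar> powr (1 / 2))"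
    using ratio \<open>1 / 2 < s\<close> finite_A A_ne by (intro sum_strict_mono powr_less_mono') auto
  then have "hausdorff_measure s K = 0" using le1 \<open>1 / 2 < s\<close> by (intro hausdorff_measure_eq_0) auto
  then have "hausdorff_dim K \<le> ennreal s" unfolding hausdorff_dim_def using s by (intro Inf_lower) auto
  then show False using y s by auto
qed

text \<open>The ratio of a word is determined by how often each letter occurs in it.\<close>

lemma card_word_ratios_le: "card (wr ` words A n) \<le> Suc n ^ card A"
proof -
  let ?P = "Pi\<^sub>E A (\<lambda>_. {..n})"
  let ?g = "\<lambda>\<phi>. \<Prod>a\<in>A. c a ^ \<phi> a"
  have prod: "set w \<subseteq> A \<Longrightarrow> wr w = (\<Prod>a\<in>A. c a ^ count_list w a)" for w
  proof (induction w)
    case (Cons b w)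
    have "(\<Prod>a\<in>A. c a ^ count_list (b # w) a) = (\<Prod>a\<in>A. (if a = b then c a else 1) * c a ^ count_list w a)"
      by (intro prod.cong) auto
    also have "\<dots> = c b * (\<Prod>a\<in>A. c a ^ count_list w a)"
      using Cons.prems finite_A by (simp add: prod.distrib)
    finally show ?case using Cons by simp
  qed simp
  have "wr ` words A n \<subseteq> ?g ` ?P"
  proof
    fix x assume "x \<in> wr ` words A n"
    then obtain w where w: "set w \<subseteq> A" "length w = n" "x = wr w" by (auto simp: words_def)
    let ?\<phi> = "restrict (count_list w) A"
    have "?\<phi> \<in> ?P" using w(2) count_le_length by fastforce
    moreover have "x = ?g ?\<phi>" using w prod by simp
    ultimately show "x \<in> ?g ` ?P" by blast
  qed
  moreover have fP: "finite ?P" using finite_A by (intro finite_PiE) auto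
  ultimately have "card (wr ` words A n) \<le> card (?g ` ?P)" by (intro card_mono) auto
  also have "\<dots> \<le> card ?P" using fP by (rule card_image_le)
  also have "\<dots> = Suc n ^ card A" using finite_A by (simp add: card_PiE)
  finally show ?thesis .
qed

lemma exists_equal_ratio_words:
  assumes gt: "1 < (\<Sum>a\<in>A. \<bar>c a\<bar> powr (1 / 2))"
  obtains n \<kappa> B where "0 < n" "B \<subseteq> words A n" "\<And>w. w \<in> B \<Longrightarrow> wr w = \<kappa>" "1 < (real (card B))\<^sup>2 * \<bar>\<kappa>\<bar>"
proof -
  obtain n where n: "0 < n" "real (Suc n) ^ card A < (\<Sum>a\<in>A. \<bar>c a\<bar> powr (1 / 2)) ^ n"
    using exists_nat_power_gt_polynomial[OF gt] by blast
  let ?V = "wr ` words A n" and ?B = "\<lambda>\<kappa>. {w\<in>words A n. wr w = \<kappa>}"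
  have fW: "finite (words A n)" using finite_A by simp
  have "\<exists>\<kappa>\<in>?V. 1 < card (?B \<kappa>) * \<bar>\<kappa>\<bar> powr (1 / 2)"
  proof (rule ccontr)
    assume "\<not> ?thesis"
    then have le: "\<And>\<kappa>. \<kappa> \<in> ?V \<Longrightarrow> card (?B \<kappa>) * \<bar>\<kappa>\<bar> powr (1 / 2) \<le> 1" by force
    have "(\<Sum>a\<in>A. \<bar>c a\<bar> powr (1 / 2)) ^ n = (\<Sum>w\<in>words A n. \<bar>wr w\<bar> powr (1 / 2))"
      by (simp add: sum_words_powr)
    also have "\<dots> = (\<Sum>\<kappa>\<in>?V. \<Sum>w\<in>?B \<kappa>. \<bar>wr w\<bar> powr (1 / 2))"
      by (rule sum.image_gen[OF fW])
    also have "\<dots> = (\<Sum>\<kappa>\<in>?V. card (?B \<kappa>) * \<bar>\<kappa>\<bar> powr (1 / 2))" by simp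
    also have "\<dots> \<le> (\<Sum>\<kappa>\<in>?V. 1)" by (intro sum_mono le)
    also have "\<dots> = real (card ?V)" by simp
    also have "\<dots> \<le> real (Suc n ^ card A)" using card_word_ratios_le of_nat_le_iff by blast
    finally show False using n(2) by simp
  qed
  then obtain \<kappa> where \<kappa>: "1 < card (?B \<kappa>) * \<bar>\<kappa>\<bar> powr (1 / 2)" by blast
  then have "1 < (card (?B \<kappa>) * \<bar>\<kappa>\<bar> powr (1 / 2))\<^sup>2" by (simp add: one_less_power)
  also have "\<dots> = (real (card (?B \<kappa>)))\<^sup>2 * \<bar>\<kappa>\<bar>"
    by (simp add: power_mult_distrib powr_half_sqrt)
  finally show thesis using n(1) by (intro that[of n "?B \<kappa>" \<kappa>]) auto
qed

text \<open>Concatenating pairs squares the common ratio, which makes it positive, and provides at least four words.\<close>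

lemma exists_homogeneous_subsystem:
  assumes "1 / 2 < hausdorff_dim K"
  obtains n q B where "0 < n" "B \<subseteq> words A n" "\<And>w. w \<in> B \<Longrightarrow> wr w = q" "0 < q" "q < 1"
    "1 < (real (card B))\<^sup>2 * q" "4 \<le> card B"
proof -
  obtain n \<kappa> B where n: "0 < n" and B: "B \<subseteq> words A n" "\<And>w. w \<in> B \<Longrightarrow> wr w = \<kappa>"
    and gt: "1 < (real (card B))\<^sup>2 * \<bar>\<kappa>\<bar>"
    using exists_equal_ratio_words[OF sum_sqrt_ratio_gt_1[OF assms]] by metis
  have fB: "finite B" using B(1) finite_A finite_subset finite_words by metis
  have "B \<noteq> {}" using gt by auto
  then obtain w where w: "w \<in> B" by blast
  have k0: "\<kappa> \<noteq> 0" using wr_ne0 B w by blast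
  have k1: "\<bar>\<kappa>\<bar> < 1" using wr_lt1[of w "n - 1"] B w n by auto
  have c2: "2 \<le> card B"
  proof (rule ccontr)
    assume "\<not> 2 \<le> card B"
    then have "real (card B) \<le> 1" by simp
    then have "(real (card B))\<^sup>2 * \<bar>\<kappa>\<bar> \<le> 1 * 1" using k1 by (intro mult_mono power_le_one) auto
    then show False using gt by simp
  qed
  let ?B = "(\<lambda>(u, v). u @ v) ` (B \<times> B)"
  have inj: "inj_on (\<lambda>(u, v). u @ v) (B \<times> B)"
  proof -
    have "length u = n" if "u \<in> B" for u using that B(1) by (auto simp: words_def)
    then show ?thesis by (auto simp: inj_on_def)
  qed
  have cB: "card ?B = card B * card B" using inj by (simp add: card_image card_cartesian_product)
  show thesis
  proof (rule that[of "2 * n" ?B "\<kappa>\<^sup>2"])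
    show "?B \<subseteq> words A (2 * n)"
    proof clarify
      fix u v assume "u \<in> B" "v \<in> B"
      then have "u \<in> words A n" "v \<in> words A n" using B(1) by blast+
      then show "u @ v \<in> words A (2 * n)" by (auto simp: words_def)
    qed
    show "wr w = \<kappa>\<^sup>2" if "w \<in> ?B" for w using that B(2) by (auto simp: word_ratio_append power2_eq_square)
    show "0 < \<kappa>\<^sup>2" using k0 by simp
    show "\<kappa>\<^sup>2 < 1" using k1 by (simp add: abs_square_less_1)
    have "1 < ((real (card B))\<^sup>2 * \<bar>\<kappa>\<bar>)\<^sup>2" using gt by (simp add: one_less_power)
    also have "((real (card B))\<^sup>2 * \<bar>\<kappa>\<bar>)\<^sup>2 = ((real (card B))\<^sup>2)\<^sup>2 * \<kappa>\<^sup>2"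
      unfolding power_mult_distrib by simp
    also have "\<dots> = (real (card ?B))\<^sup>2 * \<kappa>\<^sup>2" unfolding cB by (simp add: power2_eq_square)
    finally show "1 < (real (card ?B))\<^sup>2 * \<kappa>\<^sup>2" .
    have "2 * 2 \<le> card B * card B" using c2 by (intro mult_le_mono)
    then show "4 \<le> card ?B" unfolding cB by simp
  qed (use n in simp)
qed

end

section \<open>Perturbing a self-similar Cantor set\<close>

lemma concat_words:
  assumes B: "B \<subseteq> words A n" and c: "\<And>w. w \<in> B \<Longrightarrow> word_ratio c w = q"
  shows "ws \<in> words B m \<Longrightarrow> concat ws \<in> words A (n * m) \<and> word_ratio c (concat ws) = q ^ m \<and>
      word_offset c d (concat ws) = word_offset (\<lambda>_. q) (word_offset c d) ws"
proof (induction m arbitrary: ws)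
  case (Suc m)
  then obtain w ws' where ws: "ws = w # ws'" "w \<in> B" "ws' \<in> words B m" by (auto simp: words_Suc)
  have w: "w \<in> words A n" "word_ratio c w = q" using ws(2) B c by auto
  from Suc.IH[OF ws(3)] w show ?case
    by (auto simp: ws(1) word_ratio_append word_offset_append words_def)
qed (simp add: words_def)

text \<open>A word over $B$ can be recovered from its concatenation, since all elements of $B$ have the same length.\<close>

lemma inj_on_concat_words:
  assumes B: "B \<subseteq> words A n"
  shows "inj_on concat (words B m)"
proof (rule inj_onI)
  fix us vs assume u: "us \<in> words B m" and v: "vs \<in> words B m" and eq: "concat us = concat vs"
  have len: "length us = length vs" using u v by (simp add: words_def)
  have "length u = length v" if "(u, v) \<in> set (zip us vs)" for u v
  proof -
    have "u \<in> B" "v \<in> B" using set_zip_leftD[OF that] set_zip_rightD[OF that] u v by (auto simp: words_def)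
    then have "u \<in> words A n" "v \<in> words A n" using B by blast+
    then show ?thesis by (simp add: words_def)
  qed
  then show "us = vs" using concat_injective[OF eq len] by auto
qed

text \<open>Following the orbit of $x \in \Omega$ for $n$ steps produces a point of $K + r K$ at distance
$O(l^n)$ from $x$.\<close>

lemma invariant_set_subset_sum:
  fixes K \<Omega> :: "real set"
  assumes K: "compact K" "K \<noteq> {}" and l: "0 < l" "l < 1" and bnd: "\<And>x. x \<in> \<Omega> \<Longrightarrow> \<bar>x\<bar> \<le> C"
    and step: "\<And>x. x \<in> \<Omega> \<Longrightarrow> \<exists>p p'. (\<forall>y\<in>K. l * y + p \<in> K) \<and> (\<forall>y\<in>K. l * y + p' \<in> K) \<and>
       (x - p - r * p') / l \<in> \<Omega>"
  shows "\<Omega> \<subseteq> {x + r * y | x y. x \<in> K \<and> y \<in> K}"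
proof
  let ?S = "{x + r * y | x y. x \<in> K \<and> y \<in> K}"
  fix x assume x: "x \<in> \<Omega>"
  obtain y0 where y0: "y0 \<in> K" using K by blast
  define D where "D = C + \<bar>y0 + r * y0\<bar>"
  have approx: "\<exists>y\<in>K. \<exists>y'\<in>K. \<bar>x - (y + r * y')\<bar> \<le> D * l ^ n" if "x \<in> \<Omega>" for x n
    using that
  proof (induction n arbitrary: x)
    case 0
    have "\<bar>x - (y0 + r * y0)\<bar> \<le> D" using bnd[OF 0] unfolding D_def by linarith
    then show ?case using y0 by auto
  next
    case (Suc n)
    obtain p p' where p: "\<forall>y\<in>K. l * y + p \<in> K" "\<forall>y\<in>K. l * y + p' \<in> K" "(x - p - r * p') / l \<in> \<Omega>"
      using step[OF Suc.prems] by blast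
    obtain y y' where y: "y \<in> K" "y' \<in> K" "\<bar>(x - p - r * p') / l - (y + r * y')\<bar> \<le> D * l ^ n"
      using Suc.IH[OF p(3)] by blast
    have "x - ((l * y + p) + r * (l * y' + p')) = l * ((x - p - r * p') / l - (y + r * y'))"
      using l by (simp add: field_simps)
    then have "\<bar>x - ((l * y + p) + r * (l * y' + p'))\<bar> = l * \<bar>(x - p - r * p') / l - (y + r * y')\<bar>"
      using l by (simp add: abs_mult)
    also have "\<dots> \<le> l * (D * l ^ n)" using y(3) l by (intro mult_left_mono) auto
    finally have "\<bar>x - ((l * y + p) + r * (l * y' + p'))\<bar> \<le> D * l ^ Suc n" by (simp add: mult_ac)
    then show ?case using p y by blast
  qed
  have eq: "?S = (\<lambda>p. fst p + r * snd p) ` (K \<times> K)" by force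
  have "compact ?S" unfolding eq
    using K by (intro compact_continuous_image compact_Times continuous_intros) auto
  then have closed: "closed ?S" by (rule compact_imp_closed)
  have "(\<lambda>n. D * l ^ n) \<longlonglongrightarrow> D * 0" using l by (intro tendsto_mult tendsto_const LIMSEQ_realpow_zero) auto
  then have lim: "(\<lambda>n. D * l ^ n) \<longlonglongrightarrow> 0" by simp
  have "x \<in> closure ?S"
  proof (unfold closure_approachable, intro allI impI)
    fix e :: real assume "0 < e"
    then obtain n where n: "D * l ^ n < e"
      using order_tendstoD(2)[OF lim] by (auto simp: eventually_sequentially)
    obtain y y' where "y \<in> K" "y' \<in> K" "\<bar>x - (y + r * y')\<bar> \<le> D * l ^ n" using approx[OF x] by blast
    then show "\<exists>z\<in>?S. dist z x < e" using n by (intro bexI[of _ "y + r * y'"]) (auto simp: dist_real_def)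
  qed
  then show "x \<in> ?S" using closed by (simp add: closure_closed)
qed

text \<open>Countable alphabets are encoded as natural numbers.\<close>

lemma generates_reindexed:
  fixes W :: "'w::countable set" and c d :: "'w \<Rightarrow> real"
  assumes "finite W" and "\<And>w. w \<in> W \<Longrightarrow> 0 < \<bar>c w\<bar> \<and> \<bar>c w\<bar> < 1"
    and K: "K = (\<Union>w\<in>W. (\<lambda>x. c w * x + d w) ` K)"
    and disj: "disjoint_family_on (\<lambda>w. (\<lambda>x. c w * x + d w) ` (convex hull K)) W"
  shows "generates (to_nat ` W) (\<lambda>i x. c (from_nat i) * x + d (from_nat i)) K"
  unfolding generates_def
proof (intro conjI ballI)
  show "contracting_similarity (\<lambda>x. c (from_nat i) * x + d (from_nat i))" if "i \<in> to_nat ` W" for i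
  proof -
    obtain w where "w \<in> W" "i = to_nat w" using \<open>i \<in> to_nat ` W\<close> by blast
    then show ?thesis unfolding contracting_similarity_def
      using assms(2)[of w] by (intro exI[of _ "c w"] exI[of _ "d w"]) simp
  qed
  show "K = (\<Union>i\<in>to_nat ` W. (\<lambda>x. c (from_nat i) * x + d (from_nat i)) ` K)"
    by (subst K) simp
  show "disjoint_family_on (\<lambda>i. (\<lambda>x. c (from_nat i) * x + d (from_nat i)) ` (convex hull K)) (to_nat ` W)"
    using disj by (auto simp: disjoint_family_on_def)
qed (use assms(1) in simp)

lemma affine_image_unit_interval:
  fixes c d :: real
  assumes "c \<noteq> 0"
  shows "measure lebesgue ((\<lambda>x. c * x + d) ` {0..1}) = \<bar>c\<bar>"
    "interval_center ((\<lambda>x. c * x + d) ` {0..1}) = c / 2 + d"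
proof -
  have "(\<lambda>x. c * x + d) ` {0..1} = {min d (c + d)..max d (c + d)}"
    by (auto simp: image_affinity_atLeastAtMost)
  then show "measure lebesgue ((\<lambda>x. c * x + d) ` {0..1}) = \<bar>c\<bar>"
    "interval_center ((\<lambda>x. c * x + d) ` {0..1}) = c / 2 + d"
    by (auto simp: interval_center_def min_def max_def)
qed

lemma eps_close_translate:
  fixes c d d' \<epsilon> :: real
  assumes "c \<noteq> 0" "0 < \<epsilon>" "\<bar>d - d'\<bar> < \<epsilon> * \<bar>c\<bar>"
  shows "eps_close_intervals \<epsilon> ((\<lambda>x. c * x + d) ` {0..1}) ((\<lambda>x. c * x + d') ` {0..1})"
  using assms by (simp add: eps_close_intervals_def affine_image_unit_interval)

text \<open>At most one word of $B$ has an image containing $lo$ and at most one has an image containing $hi$. The image of any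
third word can be moved slightly without leaving the hull.\<close>

lemma (in affine_ifs) exists_interior_letter:
  assumes B: "B \<subseteq> words A n" "3 \<le> card B" and q: "\<And>w. w \<in> B \<Longrightarrow> wr w = q" "0 < q"
  obtains \<alpha> \<mu> where "\<alpha> \<in> B" "0 < \<mu>"
    "\<And>x. x \<in> {lo..hi} \<Longrightarrow> lo + \<mu> \<le> q * x + wo \<alpha> \<and> q * x + wo \<alpha> \<le> hi - \<mu>"
proof -
  obtain g where g: "0 < g" and
    gap_all: "\<forall>n. \<forall>w\<in>words A n. \<forall>w'\<in>words A n. \<forall>x\<in>{lo..hi}. \<forall>y\<in>{lo..hi}. w \<noteq> w' \<longrightarrow>
      g * \<bar>wr w\<bar> \<le> \<bar>(wr w * x + wo w) - (wr w' * y + wo w')\<bar>"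
    using word_gap by blast
  have gap: "g * \<bar>wr w\<bar> \<le> \<bar>(wr w * x + wo w) - (wr w' * y + wo w')\<bar>"
    if "w \<in> words A n" "w' \<in> words A n" "w \<noteq> w'" "x \<in> {lo..hi}" "y \<in> {lo..hi}" for n w w' x y
    using gap_all that by blast
  have J: "lo \<in> {lo..hi}" "hi \<in> {lo..hi}" using lo_le_hi by auto
  have fB: "finite B" using B(2) card.infinite by fastforce
  have inj: "inj_on (\<lambda>w. q * x + wo w) B" if x: "x \<in> {lo..hi}" for x
  proof (rule inj_onI, rule ccontr)
    fix u v assume uv: "u \<in> B" "v \<in> B" "q * x + wo u = q * x + wo v" "u \<noteq> v"
    then have "g * \<bar>wr u\<bar> \<le> \<bar>(wr u * x + wo u) - (wr v * x + wo v)\<bar>"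
      using gap[of u n v x x] B(1) x by blast
    then show False using uv q g by (simp add: mult_le_0_iff)
  qed
  have one: "card {w\<in>B. q * x + wo w = z} \<le> 1" if x: "x \<in> {lo..hi}" for x z
  proof -
    have "card {w\<in>B. q * x + wo w = z} \<le> card {z}"
      by (rule card_inj_on_le[of "\<lambda>w. q * x + wo w"]) (use inj[OF x] in \<open>auto intro: inj_on_subset\<close>)
    then show ?thesis by simp
  qed
  let ?L = "{w\<in>B. q * lo + wo w = lo}" and ?R = "{w\<in>B. q * hi + wo w = hi}"
  have "card (?L \<union> ?R) \<le> card ?L + card ?R" by (rule card_Un_le)
  also have "\<dots> \<le> 1 + 1" by (intro add_mono one J)
  finally have "card (?L \<union> ?R) < card B" using B(2) by simp
  then have "?L \<union> ?R \<noteq> B" by auto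
  then obtain \<alpha> where \<alpha>: "\<alpha> \<in> B" "q * lo + wo \<alpha> \<noteq> lo" "q * hi + wo \<alpha> \<noteq> hi" by blast
  have "\<alpha> \<in> words A n" using \<alpha> B by blast
  then have "wr \<alpha> * lo + wo \<alpha> \<in> {lo..hi}" "wr \<alpha> * hi + wo \<alpha> \<in> {lo..hi}"
    using word_map_hull J by blast+
  then have \<alpha>': "lo < q * lo + wo \<alpha>" "q * hi + wo \<alpha> < hi" using \<alpha> q by auto
  define \<mu> where "\<mu> = min (q * lo + wo \<alpha> - lo) (hi - (q * hi + wo \<alpha>))"
  show thesis
  proof (rule that[OF \<alpha>(1)])
    show "0 < \<mu>" using \<alpha>' by (simp add: \<mu>_def)
    fix x assume "x \<in> {lo..hi}"
    then have "q * lo \<le> q * x" "q * x \<le> q * hi" using q(2) by auto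
    then show "lo + \<mu> \<le> q * x + wo \<alpha> \<and> q * x + wo \<alpha> \<le> hi - \<mu>" by (auto simp: \<mu>_def min_def)
  qed
qed

text \<open>The theorem for $M \ge 1$ and a family given by coefficients. The alphabet of $K'$ consists of all
words of length $n(k+1)$, and the words $\alpha u$ with $u \in B^k$ are the only ones whose maps are
moved.\<close>

lemma exists_close_Cantor_set:
  fixes A :: "nat set"
  assumes ifs: "affine_ifs A c d K lo hi" and dim: "1 / 2 < hausdorff_dim K"
    and \<epsilon>: "0 < \<epsilon>" and M: "1 \<le> M"
  shows "\<exists>K' E. self_similar_Cantor_set K' \<and>
           E \<in> sets lebesgue \<and> E \<subseteq> {1 / M<..<M} \<and>
           measure lebesgue ({1 / M<..<M} - E) < \<epsilon> \<and>
           eps_close_Cantor_sets \<epsilon> K K' \<and>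
           (\<forall>r\<in>E. \<exists>u v. u < v \<and> {u..v} \<subseteq> {x + r * y | x y. x \<in> K' \<and> y \<in> K'})"
proof -
  interpret affine_ifs A c d K lo hi by (rule ifs)
  obtain n q B where n: "0 < n" and B: "B \<subseteq> words A n" "\<And>w. w \<in> B \<Longrightarrow> wr w = q"
    and q: "0 < q" "q < 1" and big: "1 < (real (card B))\<^sup>2 * q" "4 \<le> card B"
    using exists_homogeneous_subsystem[OF dim] by metis
  obtain g where g: "0 < g" and
    gap_all: "\<forall>n. \<forall>w\<in>words A n. \<forall>w'\<in>words A n. \<forall>x\<in>{lo..hi}. \<forall>y\<in>{lo..hi}. w \<noteq> w' \<longrightarrow>
      g * \<bar>wr w\<bar> \<le> \<bar>(wr w * x + wo w) - (wr w' * y + wo w')\<bar>"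
    using word_gap by blast
  have gap: "g * \<bar>wr w\<bar> \<le> \<bar>(wr w * x + wo w) - (wr w' * y + wo w')\<bar>"
    if "w \<in> words A n" "w' \<in> words A n" "w \<noteq> w'" "x \<in> {lo..hi}" "y \<in> {lo..hi}" for n w w' x y
    using gap_all that by blast
  obtain \<alpha> \<mu> where \<alpha>: "\<alpha> \<in> B" "0 < \<mu>"
    "\<And>x. x \<in> {lo..hi} \<Longrightarrow> lo + \<mu> \<le> q * x + wo \<alpha> \<and> q * x + wo \<alpha> \<le> hi - \<mu>"
    using exists_interior_letter[OF B(1) _ B(2) q(1)] big(2) by auto
  have fB: "finite B" using big(2) card.infinite by fastforce
  have "B \<noteq> {\<alpha>}" using big(2) by auto
  then obtain \<omega> where \<omega>: "\<omega> \<in> B" "\<omega> \<noteq> \<alpha>" using \<alpha>(1) by blast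
  interpret H: homogeneous_ifs B wo q lo hi "g * q"
  proof
    show "q * x + wo i \<in> {lo..hi}" if "i \<in> B" "x \<in> {lo..hi}" for i x
      using word_map_hull[of i n x] B that by auto
    show "g * q \<le> \<bar>(q * x + wo i) - (q * y + wo j)\<bar>"
      if "i \<in> B" "j \<in> B" "i \<noteq> j" "x \<in> {lo..hi}" "y \<in> {lo..hi}" for i j x y
      using gap[of i n j x y] B that q(1) by auto
  qed (use fB q unit lo_le_hi g in auto)
  define \<tau> where "\<tau> = min 1 (min \<mu> (min (\<epsilon> / 2) (g / 4)))"
  have \<tau>: "0 < \<tau>" "\<tau> \<le> 1" "\<tau> \<le> \<mu>" "\<tau> < \<epsilon>" "2 * \<tau> < g"
    using \<alpha>(2) \<epsilon> g by (auto simp: \<tau>_def min_def)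
  have "1 < H.\<sigma>" using big by (simp add: H.\<sigma>_def)
  then obtain k t E where t: "\<And>u. \<bar>t u\<bar> \<le> \<tau> * q ^ Suc k"
    and E: "E \<in> sets lebesgue" "E \<subseteq> {1 / M<..<M}" "measure lebesgue ({1 / M<..<M} - E) < \<epsilon>"
    and tr: "\<And>r. r \<in> E \<Longrightarrow> \<exists>\<Omega> b c C. b < c \<and> {b..c} \<subseteq> \<Omega> \<and> (\<forall>x\<in>\<Omega>. \<bar>x\<bar> \<le> C) \<and>
        (\<forall>x\<in>\<Omega>. \<exists>u\<in>words B k. \<exists>v\<in>words B k.
           (x - (H.off (\<alpha> # u) + t u) - r * H.off (\<omega> # v)) / q ^ Suc k \<in> \<Omega>)"
    using H.exists_good_translations[OF _ \<alpha>(1) \<omega>(1) M \<tau>(1,2) \<epsilon>] by metis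
  define l where "l = q ^ Suc k"
  have l: "0 < l" "l < 1" unfolding l_def using q power_Suc_less_one[of q k] by auto
  define V where "V = words A (n * Suc k)"
  have fV: "finite V" using finite_A by (simp add: V_def)
  have V: "concat ws \<in> V" "wr (concat ws) = l" "wo (concat ws) = H.off ws" if "ws \<in> words B (Suc k)" for ws
    using concat_words[OF B that] unfolding V_def l_def by auto
  have wrV: "0 < \<bar>wr w\<bar> \<and> \<bar>wr w\<bar> < 1" if "w \<in> V" for w
    using wr_ne0[of w "n * Suc k"] wr_lt1[of w "n * Suc k - 1"] that n by (auto simp: V_def)
  have inj: "inj_on concat (words B (Suc k))" by (rule inj_on_concat_words[OF B(1)])
  \<comment> \<open>the perturbed words, flattened to words over the original alphabet, and their translations\<close>
  define P where "P = (\<lambda>u. concat (\<alpha> # u)) ` words B k"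
  define T where "T w = (if w \<in> P then t (tl (the_inv_into (words B (Suc k)) concat w)) else 0)" for w
  have TP: "T (concat (\<alpha> # u)) = t u" if "u \<in> words B k" for u
  proof -
    have "\<alpha> # u \<in> words B (Suc k)" using that \<alpha>(1) by (simp add: words_Cons_iff)
    then have "the_inv_into (words B (Suc k)) concat (concat (\<alpha> # u)) = \<alpha> # u"
      by (rule the_inv_into_f_f[OF inj])
    moreover have "concat (\<alpha> # u) \<in> P" using that by (auto simp: P_def)
    ultimately show ?thesis unfolding T_def by simp
  qed
  have T\<omega>: "T (concat (\<omega> # v)) = 0" if "v \<in> words B k" for v
  proof -
    have "concat (\<omega> # v) \<notin> P"
    proof
      assume "concat (\<omega> # v) \<in> P"
      then obtain u where u: "u \<in> words B k" "concat (\<omega> # v) = concat (\<alpha> # u)" by (auto simp: P_def)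
      then have "\<omega> # v = \<alpha> # u"
        using inj_onD[OF inj u(2)] that \<alpha>(1) \<omega>(1) by (simp add: words_Cons_iff)
      then show False using \<omega>(2) by simp
    qed
    then show ?thesis by (simp add: T_def)
  qed
  have P: "wr w = l" "\<exists>u\<in>words B k. w = concat (\<alpha> # u) \<and> wo w = H.off (\<alpha> # u)" if "w \<in> P" for w
  proof -
    obtain u where u: "u \<in> words B k" "w = concat (\<alpha> # u)" using \<open>w \<in> P\<close> by (auto simp: P_def)
    have "\<alpha> # u \<in> words B (Suc k)" using u(1) \<alpha>(1) by (simp add: words_Cons_iff)
    from V(2,3)[OF this] u show "wr w = l" "\<exists>u\<in>words B k. w = concat (\<alpha> # u) \<and> wo w = H.off (\<alpha> # u)"
      by auto
  qed
  have T_le: "\<bar>T w\<bar> \<le> \<tau> * l" for w using t l \<tau>(1) by (simp add: T_def l_def)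
  have T0: "T w = 0" if "w \<notin> P" for w using that by (simp add: T_def)
  define d' where "d' w = wo w + T w" for w
  have into: "wr w * x + d' w \<in> {lo..hi}" if w: "w \<in> V" and x: "x \<in> {lo..hi}" for w x
  proof (cases "w \<in> P")
    case True
    then obtain u where u: "u \<in> words B k" "wo w = H.off (\<alpha> # u)" using P(2) by blast
    have "q ^ k * x + H.off u \<in> {lo..hi}" by (rule H.point_in_hull[OF u(1) x])
    from \<alpha>(3)[OF this] have "lo + \<mu> \<le> wr w * x + wo w \<and> wr w * x + wo w \<le> hi - \<mu>"
      unfolding P(1)[OF True] u(2) l_def by (simp add: algebra_simps)
    moreover have "\<bar>T w\<bar> \<le> \<mu>"
    proof -
      have "\<tau> * l \<le> \<mu> * 1" using \<tau> l by (intro mult_mono) auto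
      then show ?thesis using T_le[of w] by linarith
    qed
    ultimately show ?thesis unfolding d'_def atLeastAtMost_iff by linarith
  next
    case False
    then show ?thesis using word_map_hull[of w "n * Suc k" x] w x by (simp add: d'_def T0 V_def)
  qed
  have sep: "wr w * x + d' w \<noteq> wr w' * y + d' w'"
    if w: "w \<in> V" "w' \<in> V" "w \<noteq> w'" and xy: "x \<in> {lo..hi}" "y \<in> {lo..hi}" for w w' x y
  proof
    assume "wr w * x + d' w = wr w' * y + d' w'"
    then have eq: "(wr w * x + wo w) - (wr w' * y + wo w') = T w' - T w" by (simp add: d'_def)
    have gaps: "g * \<bar>wr w\<bar> \<le> \<bar>T w' - T w\<bar>" "g * \<bar>wr w'\<bar> \<le> \<bar>T w' - T w\<bar>"
      using gap[of w "n * Suc k" w' x y] gap[of w' "n * Suc k" w y x] w xy eq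
      by (simp_all add: V_def abs_minus_commute)
    have "\<bar>T w' - T w\<bar> \<le> 2 * \<tau> * l" using T_le[of w] T_le[of w'] by linarith
    also have "\<dots> < g * l" using \<tau>(5) l by (intro mult_strict_right_mono) auto
    finally have lt: "\<bar>T w' - T w\<bar> < g * l" .
    show False
    proof (cases "w \<in> P \<or> w' \<in> P")
      case True
      then have "\<bar>wr w\<bar> = l \<or> \<bar>wr w'\<bar> = l" using P(1) l by auto
      then show False using gaps lt by auto
    next
      case False
      then have "g * \<bar>wr w\<bar> \<le> 0" using gaps T0 by simp
      moreover have "0 < g * \<bar>wr w\<bar>" using g wrV[OF w(1)] by simp
      ultimately show False by linarith
    qed
  qed
  have disj': "disjoint_family_on (\<lambda>w. (\<lambda>x. wr w * x + d' w) ` {lo..hi}) V"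
    unfolding disjoint_family_on_def using sep by blast
  have "(\<Union>w\<in>V. (\<lambda>x. wr w * x + wo w) ` K) = K" unfolding V_def by (rule K_words[symmetric])
  then have V_ne: "V \<noteq> {}" using K_ne by auto
  have wr_ne: "wr w \<noteq> 0" if "w \<in> V" for w using wrV[OF that] by simp
  have "\<exists>K'. compact K' \<and> K' \<noteq> {} \<and> K' \<subseteq> {lo..hi} \<and> K' = (\<Union>w\<in>V. (\<lambda>x. wr w * x + d' w) ` K')"
    using fV V_ne lo_le_hi by (rule attractor_exists) (fact wr_ne into disj')+
  then obtain K' where K': "compact K'" "K' \<noteq> {}" "K' \<subseteq> {lo..hi}" "K' = (\<Union>w\<in>V. (\<lambda>x. wr w * x + d' w) ` K')"
    by (elim exE conjE) (rule that)
  have gen: "generates (to_nat ` V) (\<lambda>i x. wr (from_nat i) * x + wo (from_nat i)) K"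
  proof (rule generates_reindexed[OF fV wrV])
    show "K = (\<Union>w\<in>V. (\<lambda>x. wr w * x + wo w) ` K)" unfolding V_def by (rule K_words)
    have "wr w * x + wo w \<noteq> wr w' * y + wo w'"
      if w: "w \<in> V" "w' \<in> V" "w \<noteq> w'" and xy: "x \<in> {lo..hi}" "y \<in> {lo..hi}" for w w' x y
    proof
      assume "wr w * x + wo w = wr w' * y + wo w'"
      then have "g * \<bar>wr w\<bar> \<le> 0" using gap[of w "n * Suc k" w' x y] w xy by (simp add: V_def)
      moreover have "0 < g * \<bar>wr w\<bar>" using g wrV[OF w(1)] by simp
      ultimately show False by linarith
    qed
    then show "disjoint_family_on (\<lambda>w. (\<lambda>x. wr w * x + wo w) ` (convex hull K)) V"
      unfolding disjoint_family_on_def hull by blast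
  qed
  have gen': "generates (to_nat ` V) (\<lambda>i x. wr (from_nat i) * x + d' (from_nat i)) K'"
  proof (rule generates_reindexed[OF fV wrV K'(4)])
    have "convex hull K' \<subseteq> {lo..hi}" by (rule hull_minimal[OF K'(3)]) simp
    then show "disjoint_family_on (\<lambda>w. (\<lambda>x. wr w * x + d' w) ` (convex hull K')) V"
      using disj' unfolding disjoint_family_on_def by blast
  qed
  have "K' \<subseteq> {0..1}" by (rule order_trans[OF K'(3)]) (use unit in auto)
  then have K'_ss: "self_similar_Cantor_set K'"
    unfolding self_similar_Cantor_set_def using K'(1,2) gen' by blast
  have close: "eps_close_Cantor_sets \<epsilon> K K'"
    unfolding eps_close_Cantor_sets_def
  proof (intro exI conjI ballI)
    fix i assume "i \<in> to_nat ` V"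
    then obtain w where w: "w \<in> V" "from_nat i = w" by auto
    have "\<bar>T w\<bar> < \<epsilon> * \<bar>wr w\<bar>"
    proof (cases "w \<in> P")
      case True
      have "\<tau> * l < \<epsilon> * l" using \<tau>(4) l by (intro mult_strict_right_mono) auto
      then have "\<bar>T w\<bar> < \<epsilon> * l" using T_le[of w] by linarith
      then show ?thesis using P(1)[OF True] l by simp
    next
      case False
      then show ?thesis using wrV[OF w(1)] \<epsilon> by (simp add: T0)
    qed
    then show "eps_close_intervals \<epsilon> ((\<lambda>x. wr (from_nat i) * x + wo (from_nat i)) ` {0..1})
        ((\<lambda>x. wr (from_nat i) * x + d' (from_nat i)) ` {0..1})"
      unfolding w(2) using wrV[OF w(1)] \<epsilon> by (intro eps_close_translate) (auto simp: d'_def)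
  qed (fact gen gen')+
  have sum: "\<exists>u v. u < v \<and> {u..v} \<subseteq> {x + r * y | x y. x \<in> K' \<and> y \<in> K'}" if r: "r \<in> E" for r
  proof -
    obtain \<Omega> b e C where O: "b < e" "{b..e} \<subseteq> \<Omega>" "\<forall>x\<in>\<Omega>. \<bar>x\<bar> \<le> C"
      "\<forall>x\<in>\<Omega>. \<exists>u\<in>words B k. \<exists>v\<in>words B k.
           (x - (H.off (\<alpha> # u) + t u) - r * H.off (\<omega> # v)) / q ^ Suc k \<in> \<Omega>"
      using tr[OF r] by blast
    have mem: "wr w * y + d' w \<in> K'" if "w \<in> V" "y \<in> K'" for w y
      using K'(4) that by blast
    have "\<Omega> \<subseteq> {x + r * y | x y. x \<in> K' \<and> y \<in> K'}"
    proof (rule invariant_set_subset_sum[OF K'(1,2) l])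
      show "\<bar>x\<bar> \<le> C" if "x \<in> \<Omega>" for x using O(3) that by blast
      fix x assume "x \<in> \<Omega>"
      then obtain u v where u: "u \<in> words B k" and v: "v \<in> words B k"
        and x': "(x - (H.off (\<alpha> # u) + t u) - r * H.off (\<omega> # v)) / q ^ Suc k \<in> \<Omega>"
        using O(4) by blast
      have \<alpha>u: "\<alpha> # u \<in> words B (Suc k)" using u \<alpha>(1) by (simp add: words_Cons_iff)
      have \<omega>v: "\<omega> # v \<in> words B (Suc k)" using v \<omega>(1) by (simp add: words_Cons_iff)
      have "l * y + (H.off (\<alpha> # u) + t u) \<in> K'" if "y \<in> K'" for y
        using mem[OF V(1)[OF \<alpha>u] that] V(2,3)[OF \<alpha>u] TP[OF u] unfolding d'_def by simp
      moreover have "l * y + H.off (\<omega> # v) \<in> K'" if "y \<in> K'" for y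
        using mem[OF V(1)[OF \<omega>v] that] V(2,3)[OF \<omega>v] T\<omega>[OF v] unfolding d'_def by simp
      ultimately show "\<exists>p p'. (\<forall>y\<in>K'. l * y + p \<in> K') \<and> (\<forall>y\<in>K'. l * y + p' \<in> K') \<and>
          (x - p - r * p') / l \<in> \<Omega>"
        using x' unfolding l_def by blast
    qed
    then show ?thesis using O(1,2) by blast
  qed
  show ?thesis
    by (rule exI[of _ K'], rule exI[of _ E], intro conjI ballI) (fact K'_ss E close sum)+
qed

theorem theorem1p2:
  fixes K :: "real set" and \<epsilon> M :: real
  assumes "self_similar_Cantor_set K"
    and "hausdorff_dim K > 1 / 2"
    and "\<epsilon> > 0" and "M > 0"
  shows "\<exists>K' E. self_similar_Cantor_set K' \<and>
           E \<in> sets lebesgue \<and> E \<subseteq> {1 / M<..<M} \<and>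
           measure lebesgue ({1 / M<..<M} - E) < \<epsilon> \<and>
           eps_close_Cantor_sets \<epsilon> K K' \<and>
           (\<forall>r\<in>E. \<exists>u v. u < v \<and> {u..v} \<subseteq> {x + r * y | x y. x \<in> K' \<and> y \<in> K'})"
proof -
  obtain A :: "nat set" and f where K: "K \<noteq> {}" "compact K" "K \<subseteq> {0..1}" and gen: "generates A f K"
    using assms(1) unfolding self_similar_Cantor_set_def by blast
  have "\<exists>c d. a \<in> A \<longrightarrow> 0 < \<bar>c\<bar> \<and> \<bar>c\<bar> < 1 \<and> f a = (\<lambda>x. c * x + d)" for a
    using gen unfolding generates_def contracting_similarity_def by blast
  then obtain c d where cd: "\<And>a. a \<in> A \<Longrightarrow> 0 < \<bar>c a\<bar> \<and> \<bar>c a\<bar> < 1 \<and> f a = (\<lambda>x. c a * x + d a)"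
    by metis
  have fin: "finite A" and Keq: "K = (\<Union>a\<in>A. f a ` K)"
    and disj: "disjoint_family_on (\<lambda>a. f a ` (convex hull K)) A"
    using gen by (auto simp: generates_def)
  have "connected (convex hull K)" "compact (convex hull K)"
    using K(2) by (auto intro: convex_connected compact_convex_hull)
  then obtain lo hi where hull: "convex hull K = {lo..hi}" 
    using connected_compact_interval_1[of "convex hull K"] by blast
  have "K \<subseteq> {lo..hi}" using hull hull_subset by metis
  have sub: "{lo..hi} \<subseteq> {0..1}" unfolding hull[symmetric] using K(3) by (intro hull_minimal) auto
  have "{lo..hi} \<noteq> {}" using K(1) \<open>K \<subseteq> {lo..hi}\<close> by auto
  then have unit: "0 \<le> lo" "hi \<le> 1" using sub by auto
  have ifs: "affine_ifs A c d K lo hi"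
  proof
    have "(\<Union>a\<in>A. f a ` K) = (\<Union>a\<in>A. (\<lambda>x. c a * x + d a) ` K)" using cd by (intro SUP_cong) auto
    then show "K = (\<Union>a\<in>A. (\<lambda>x. c a * x + d a) ` K)" using Keq by simp
    show "disjoint_family_on (\<lambda>a. (\<lambda>x. c a * x + d a) ` {lo..hi}) A"
      using disj cd unfolding disjoint_family_on_def hull by metis
  qed (use fin cd K(1) hull unit in auto)
  \<comment> \<open>for $M < 1$ both intervals are empty\<close>
  define M' where "M' = max M 1"
  have "{1 / M'<..<M'} = {1 / M<..<M}"
  proof (cases "1 \<le> M")
    case False
    then have "M \<le> 1 / M" using assms(4) by (simp add: field_simps mult_le_one)
    then show ?thesis using False by (simp add: M'_def)
  qed (simp add: M'_def max_def)
  moreover have "1 \<le> M'" by (simp add: M'_def)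
  ultimately show ?thesis
    using exists_close_Cantor_set[OF ifs assms(2) assms(3), of M'] by simp
qed

end
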